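(* Let $d,\ell,n\in\mathbb{Z}_{>0}$ with $\ell\leq n$, and let $\mathbf{k}=(k_1,\dots,k_\ell)$ be a composition of $n$ with all $k_i>0$. Let $V=\mathbb{C}^n$. Then the actions of $A_{(\ell,d)}$ and of $\mathbf{GL}_{\mathbf{k}}=\mathbf{GL}_{k_1}(\mathbb{C})\times\dots\times\mathbf{GL}_{k_\ell}(\mathbb{C})$ on $V^{\otimes d}$ (described in the context) have the double centralizer property: in $\mathrm{End}_{\mathbb{C}}(V^{\otimes d})$, the image of $A_{(\ell,d)}$ is the centralizer of the image of $\mathbb{C}[\mathbf{GL}_{\mathbf{k}}]$, and the image of $\mathbb{C}[\mathbf{GL}_{\mathbf{k}}]$ is the centralizer of the image of $A_{(\ell,d)}$.
   Context: Write $\underline{n}=\{1,\dots,n\}$. The groupoid $\mathcal{G}_{(\ell,d)}$: objects are all maps $f:\underline{d}\to\underline{\ell}$; morphisms from $f$ to $g$ are all bijections $\sigma:\underline{d}\to\underline{d}$ with $g\circ\sigma=f$; composition is composition of maps. The algebra $A_{(\ell,d)}=\bigoplus_{f,g}\mathbb{C}[\mathcal{G}_{(\ell,d)}(f,g)]$ has all morphisms as basis, with product of two morphisms equal to their composition if defined and $0$ otherwise. $V=\mathbb{C}^n$ has standard basis $v_1,\dots,v_n$, and $\mathbf{GL}_{\mathbf{k}}\subset\mathbf{GL}_n(\mathbb{C})$ is the subgroup of block diagonal matrices with blocks of sizes $k_1,\dots,k_\ell$; it acts on $V$ naturally and on $V^{\otimes d}$ diagonally ($x(w_1\otimes\dots\otimes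 w_d)=xw_1\otimes\dots\otimes xw_d$). Let $V_i$ be the span of $v_j$ with $k_1+\dots+k_{i-1}<j\leq k_1+\dots+k_i$, so $V=V_1\oplus\dots\oplus V_\ell$. For an object $f$ put $\mathrm{G}(f)=V_{f(1)}\otimes\dots\otimes V_{f(d)}$, so that $V^{\otimes d}=\bigoplus_f\mathrm{G}(f)$. A morphism $\sigma\in\mathcal{G}_{(\ell,d)}(f,g)$ acts on $V^{\otimes d}$ by mapping $\mathrm{G}(f)$ to $\mathrm{G}(g)$ via $w_1\otimes\dots\otimes w_d\mapsto w_{\sigma^{-1}(1)}\otimes\dots\otimes w_{\sigma^{-1}(d)}$ and by zero on $\mathrm{G}(f')$ for $f'\neq f$; this makes $V^{\otimes d}$ an $A_{(\ell,d)}$-module. *)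

theory Defs
  imports "HOL-Analysis.Analysis"
begin

text \<open>
  The index sets \<open>{1..n}\<close>, \<open>{1..l}\<close>, \<open>{1..d}\<close> are rendered as finite types
  \<open>'n\<close>, \<open>'l\<close>, \<open>'d\<close>, the first two linearly ordered (a finite linear order with \<open>n\<close>
  elements is uniquely isomorphic to \<open>{1..n}\<close>, via \<open>pos\<close> below). Types are nonempty, so
  \<open>n, l, d > 0\<close>.
\<close>

definition pos :: "'a::{finite,linorder} \<Rightarrow> nat" where
  "pos j = card {i. i \<le> j}"

definition block :: "('l::{finite,linorder} \<Rightarrow> nat) \<Rightarrow> 'l \<Rightarrow> 'n::{finite,linorder} set" where
  "block k i = {j. (\<Sum>i'\<in>{..<i}. k i') < pos j \<and> pos j \<le> (\<Sum>i'\<in>{..i}. k i')}"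

definition V_part ::
  "('l::{finite,linorder} \<Rightarrow> nat) \<Rightarrow> 'l \<Rightarrow> (complex ^ 'n::{finite,linorder}) set" where
  "V_part k i = vec.span {axis j 1 | j. j \<in> block k i}"

definition GL ::
  "('l::{finite,linorder} \<Rightarrow> nat) \<Rightarrow> (complex ^ 'n::{finite,linorder} ^ 'n::{finite,linorder}) set" where
  "GL k = {x. invertible x \<and>
     (\<forall>p q. x $ p $ q \<noteq> 0 \<longrightarrow> (\<exists>i. p \<in> block k i \<and> q \<in> block k i))}"

text \<open>
  The \<open>d\<close>-th tensor power of \<open>\<complex>^n\<close> is modelled by its coordinates with respect to the
  basis of pure tensors of standard basis vectors, which is indexed by the maps \<open>'d \<Rightarrow> 'n\<close>.
\<close>

type_synonym ('d, 'n) tensor = "complex ^ ('d \<Rightarrow> 'n)"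

definition pure_tensor :: "('d::finite \<Rightarrow> complex ^ 'n) \<Rightarrow> ('d, 'n::finite) tensor" where
  "pure_tensor w = (\<chi> p. \<Prod>s\<in>UNIV. w s $ p s)"

definition G ::
  "('l::{finite,linorder} \<Rightarrow> nat) \<Rightarrow> ('d::finite \<Rightarrow> 'l) \<Rightarrow> ('d, 'n::{finite,linorder}) tensor set"
  where "G k f = vec.span {pure_tensor w | w. \<forall>s. w s \<in> V_part k (f s)}"

definition endos :: "(complex ^ 'a \<Rightarrow> complex ^ 'a) set" where
  "endos = {T. Vector_Spaces.linear (*s) (*s) T}"

definition centralizer ::
  "(complex ^ 'a \<Rightarrow> complex ^ 'a) set \<Rightarrow> (complex ^ 'a \<Rightarrow> complex ^ 'a) set" where
  "centralizer S = {T \<in> endos. \<forall>U\<in>S. T \<circ> U = U \<circ> T}"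

text \<open>The vector space \<open>\<complex>[X]\<close> with basis \<open>X\<close>.\<close>

definition free_space :: "'b set \<Rightarrow> ('b \<Rightarrow> complex) set" where
  "free_space X = {a. finite {x. a x \<noteq> 0} \<and> {x. a x \<noteq> 0} \<subseteq> X}"

text \<open>
  The bilinear product on \<open>\<complex>[X]\<close> which on basis elements is given by the partial operation
  \<open>m\<close>, and is \<open>0\<close> where \<open>m\<close> is undefined.
\<close>

definition conv ::
  "('b \<Rightarrow> 'b \<Rightarrow> 'b option) \<Rightarrow> ('b \<Rightarrow> complex) \<Rightarrow> ('b \<Rightarrow> complex) \<Rightarrow> 'b \<Rightarrow> complex" where
  "conv m a b z = (\<Sum>(x, y) | a x \<noteq> 0 \<and> b y \<noteq> 0 \<and> m x y = Some z. a x * b y)"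

text \<open>The linear extension to \<open>\<complex>[X]\<close> of a family of operators indexed by \<open>X\<close>.\<close>

definition lin_ext ::
  "('b \<Rightarrow> complex ^ 'a \<Rightarrow> complex ^ 'a) \<Rightarrow> ('b \<Rightarrow> complex) \<Rightarrow> complex ^ 'a \<Rightarrow> complex ^ 'a" where
  "lin_ext \<rho> a t = (\<Sum>x | a x \<noteq> 0. a x *s \<rho> x t)"

text \<open>
  The two actions are given, as unique linear maps, by their values on pure tensors. Existence and
  uniqueness are the lemmas \<open>gl_act_pure\<close>, \<open>mor_act_pure\<close>, \<open>mor_act_zero\<close> and the coordinate
  formulas \<open>gl_act_coord\<close>, \<open>mor_act_coord\<close>; that the linear extensions are multiplicative is
  \<open>A_module\<close> and \<open>GL_module\<close>.
\<close>

definition gl_act ::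
  "complex ^ 'n ^ 'n \<Rightarrow> ('d::finite, 'n::finite) tensor \<Rightarrow> ('d, 'n) tensor" where
  "gl_act x = (THE T. T \<in> endos \<and> (\<forall>w. T (pure_tensor w) = pure_tensor (\<lambda>s. x *v w s)))"

text \<open>A morphism \<open>\<sigma>\<close> from \<open>f\<close> to \<open>g\<close> is recorded together with its source and target.\<close>

type_synonym ('d, 'l) mor = "('d \<Rightarrow> 'l) \<times> ('d \<Rightarrow> 'd) \<times> ('d \<Rightarrow> 'l)"

definition Mor :: "('d, 'l) mor set" where
  "Mor = {(f, \<sigma>, g). bij \<sigma> \<and> g \<circ> \<sigma> = f}"

fun mor_comp :: "('d, 'l) mor \<Rightarrow> ('d, 'l) mor \<Rightarrow> ('d, 'l) mor option" where
  "mor_comp (g', \<tau>, h) (f, \<sigma>, g) = (if g' = g then Some (f, \<tau> \<circ> \<sigma>, h) else None)"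

fun mor_act ::
  "('l::{finite,linorder} \<Rightarrow> nat) \<Rightarrow> ('d::finite, 'l) mor \<Rightarrow>
   ('d, 'n::{finite,linorder}) tensor \<Rightarrow> ('d, 'n) tensor" where
  "mor_act k (f, \<sigma>, g) = (THE T. T \<in> endos \<and>
     (\<forall>w. (\<forall>s. w s \<in> V_part k (f s)) \<longrightarrow> T (pure_tensor w) = pure_tensor (\<lambda>s. w (inv \<sigma> s))) \<and>
     (\<forall>f'. f' \<noteq> f \<longrightarrow> (\<forall>t\<in>G k f'. T t = 0)))"

declare mor_act.simps [simp del]

text \<open>
  The algebra \<open>A\<close> is \<open>free_space Mor\<close> with product \<open>conv mor_comp\<close>; the group algebra of
  \<open>GL k\<close> is \<open>free_space (GL k)\<close> with product \<open>conv (\<lambda>x y. Some (x ** y))\<close>. Their images in the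
  endomorphisms of the tensor power are as follows.
\<close>

definition A_image ::
  "('l::{finite,linorder} \<Rightarrow> nat) \<Rightarrow>
   (('d::finite, 'n::{finite,linorder}) tensor \<Rightarrow> ('d, 'n) tensor) set" where
  "A_image k = lin_ext (mor_act k) ` free_space Mor"

definition GL_image ::
  "('l::{finite,linorder} \<Rightarrow> nat) \<Rightarrow>
   (('d::finite, 'n::{finite,linorder}) tensor \<Rightarrow> ('d, 'n) tensor) set" where
  "GL_image k = lin_ext gl_act ` free_space (GL k)"

lemma endosI:
  assumes "\<And>s t. T (s + t) = T s + T t" "\<And>c t. T (c *s t) = c *s T t"
  shows "T \<in> endos"
  unfolding endos_def using assms
  by (auto simp: Vector_Spaces.linear_iff vec.vector_space_axioms)

lemma endosD:
  assumes "T \<in> endos"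
  shows "T (s + t) = T s + T t" "T (c *s t) = c *s T t" "T (\<Sum>x\<in>A. h x) = (\<Sum>x\<in>A. T (h x))"
proof -
  interpret T: Vector_Spaces.linear "(*s)" "(*s)" T using assms by (simp add: endos_def)
  show "T (s + t) = T s + T t" "T (c *s t) = c *s T t" "T (\<Sum>x\<in>A. h x) = (\<Sum>x\<in>A. T (h x))"
    by (rule T.add T.scale T.sum)+
qed

lemma pos_strict_mono: "i < j \<Longrightarrow> pos i < pos j"
  unfolding pos_def
proof (rule psubset_card_mono)
  assume "i < j"
  then have "{a. a \<le> i} \<subseteq> {a. a \<le> j}" "j \<in> {a. a \<le> j} - {a. a \<le> i}" by auto
  then show "{a. a \<le> i} \<subset> {a. a \<le> j}" by blast
qed simp

lemma bij_pos: "bij_betw pos (UNIV :: 'a::{finite,linorder} set) {1..CARD('a)}"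
proof -
  have inj: "inj (pos :: 'a \<Rightarrow> nat)"
    by (rule injI) (metis pos_strict_mono less_irrefl linorder_neqE)
  have sub: "range (pos :: 'a \<Rightarrow> nat) \<subseteq> {1..CARD('a)}"
  proof safe
    fix j :: 'a
    have "card {i. i \<le> j} > 0" by (auto simp: card_gt_0_iff)
    moreover have "card {i. i \<le> j} \<le> CARD('a)" by (rule card_mono) auto
    ultimately show "pos j \<in> {1..CARD('a)}" by (simp add: pos_def)
  qed
  have "range (pos :: 'a \<Rightarrow> nat) = {1..CARD('a)}"
    using card_subset_eq[OF _ sub] card_image[OF inj] by simp
  then show ?thesis using inj by (simp add: bij_betw_def)
qed

lemma ex1_block:
  fixes k :: "'l::{finite,linorder} \<Rightarrow> nat" and j :: "'n::{finite,linorder}"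
  assumes k: "(\<Sum>i\<in>UNIV. k i) = CARD('n)"
  shows "\<exists>!i. j \<in> block k i"
proof (rule ex_ex1I)
  have pj: "1 \<le> pos j" "pos j \<le> CARD('n)"
    using bij_pos[where 'a='n] by (auto simp: bij_betw_def)
  let ?S = "{i. pos j \<le> (\<Sum>i'\<in>{..i}. k i')}"
  have "{..Max (UNIV :: 'l set)} = UNIV" by auto
  then have "Max UNIV \<in> ?S" using pj k by simp
  then have ne: "?S \<noteq> {}" by blast
  define i where "i = Min ?S"
  have iS: "i \<in> ?S" unfolding i_def using ne by (intro Min_in) auto
  have "(\<Sum>i'\<in>{..<i}. k i') < pos j"
  proof (cases "{..<i} = {}")
    case True
    then show ?thesis using pj by simp
  next
    case False
    define m where "m = Max {..<i}"
    have m: "m < i" unfolding m_def using False Max_in[of "{..<i}"] by auto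
    have "{..<i} = {..m}" using m unfolding m_def by (auto intro: Max_ge)
    moreover have "m \<notin> ?S" using m Min_le[of ?S m] unfolding i_def by (meson finite leD)
    ultimately show ?thesis by simp
  qed
  then show "\<exists>i. j \<in> block k i" using iS by (auto simp: block_def)
next
  have *: False if "i1 < i2" "j \<in> block k i1" "j \<in> block k i2" for i1 i2 :: 'l
  proof -
    have "(\<Sum>i'\<in>{..i1}. k i') \<le> (\<Sum>i'\<in>{..<i2}. k i')"
      by (rule sum_mono2) (use that in auto)
    then show False using that by (auto simp: block_def)
  qed
  fix i1 i2 assume "j \<in> block k i1" "j \<in> block k i2"
  then show "i1 = i2" using * by (metis linorder_neqE)
qed

lemma card_block:
  fixes k :: "'l::{finite,linorder} \<Rightarrow> nat"
  assumes k: "(\<Sum>i\<in>UNIV. k i) = CARD('n::{finite,linorder})"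
  shows "card (block k i :: 'n set) = k i"
proof -
  let ?I = "{(\<Sum>i'\<in>{..<i}. k i')<..(\<Sum>i'\<in>{..i}. k i')}"
  have le: "(\<Sum>i'\<in>{..i}. k i') \<le> CARD('n)"
    unfolding k[symmetric] by (rule sum_mono2) auto
  have "pos ` (block k i :: 'n set) = ?I"
  proof (intro equalityI subsetI)
    fix x assume "x \<in> pos ` (block k i :: 'n set)"
    then show "x \<in> ?I" by (auto simp: block_def)
  next
    fix x assume x: "x \<in> ?I"
    then have "x \<in> range (pos :: 'n \<Rightarrow> nat)"
      using bij_pos[where 'a='n] le by (auto simp: bij_betw_def)
    then show "x \<in> pos ` (block k i :: 'n set)" using x by (auto simp: block_def)
  qed
  moreover have "inj_on pos (block k i :: 'n set)"
    using bij_pos[where 'a='n] by (auto simp: bij_betw_def intro: inj_on_subset)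
  ultimately have "card (block k i :: 'n set) = card ?I" by (metis card_image)
  also have "\<dots> = k i"
    by (simp add: ivl_disj_un(2)[symmetric])
  finally show ?thesis .
qed

lemma V_part_iff: "v \<in> V_part k i \<longleftrightarrow> (\<forall>j. v $ j \<noteq> 0 \<longrightarrow> j \<in> block k i)"
proof
  assume "v \<in> V_part k i"
  then have "v \<in> vec.span {axis j 1 | j. j \<in> block k i}" by (simp add: V_part_def)
  then show "\<forall>j. v $ j \<noteq> 0 \<longrightarrow> j \<in> block k i"
    by (induction rule: vec.span_induct_alt) (auto simp: axis_def split: if_splits)
next
  assume *: "\<forall>j. v $ j \<noteq> 0 \<longrightarrow> j \<in> block k i"
  have "(\<Sum>j\<in>UNIV. (v $ j) *s axis j 1) \<in> V_part k i"
    unfolding V_part_def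
  proof (rule vec.span_sum)
    fix j
    show "(v $ j) *s axis j 1 \<in> vec.span {axis j 1 | j. j \<in> block k i}"
    proof (cases "v $ j = 0")
      case True
      then show ?thesis by (simp add: vec.span_zero)
    next
      case False
      then show ?thesis by (intro vec.span_scale vec.span_base) (use * in blast)
    qed
  qed
  then show "v \<in> V_part k i" by (simp add: basis_expansion)
qed

lemma axis_eq_pure_tensor: "axis p 1 = pure_tensor (\<lambda>s. axis (p s) 1)"
proof -
  have "(\<Prod>s\<in>UNIV. axis (p s) (1::complex) $ q s) = (if q = p then 1 else 0)" for q
  proof (cases "q = p")
    case False
    then obtain s where "q s \<noteq> p s" by auto
    then have "axis (p s) (1::complex) $ q s = 0" by (simp add: axis_def)
    then show ?thesis using False by (auto intro!: prod_zero)
  qed (simp add: axis_def)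
  then show ?thesis by (simp add: pure_tensor_def vec_eq_iff axis_def)
qed

lemma G_iff: "t \<in> G k f \<longleftrightarrow> (\<forall>p. t $ p \<noteq> 0 \<longrightarrow> (\<forall>s. p s \<in> block k (f s)))"
proof
  assume "t \<in> G k f"
  then have "t \<in> vec.span {pure_tensor w | w. \<forall>s. w s \<in> V_part k (f s)}" by (simp add: G_def)
  then show "\<forall>p. t $ p \<noteq> 0 \<longrightarrow> (\<forall>s. p s \<in> block k (f s))"
  proof (induction rule: vec.span_induct_alt)
    case (step c x y)
    then obtain w where x: "x = pure_tensor w" and w: "\<forall>s. w s \<in> V_part k (f s)" by auto
    have "p s \<in> block k (f s)" if "x $ p \<noteq> 0" for p s
    proof -
      have "w s $ p s \<noteq> 0" using that by (auto simp: x pure_tensor_def)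
      then show ?thesis using w by (auto simp: V_part_iff)
    qed
    then show ?case using step.IH by (metis add_0 mult_zero_right vector_add_component vector_smult_component)
  qed simp
next
  assume *: "\<forall>p. t $ p \<noteq> 0 \<longrightarrow> (\<forall>s. p s \<in> block k (f s))"
  have "(\<Sum>p\<in>UNIV. (t $ p) *s axis p 1) \<in> G k f"
    unfolding G_def
  proof (rule vec.span_sum)
    fix p
    have "axis p 1 \<in> {pure_tensor w | w. \<forall>s. w s \<in> V_part k (f s)}" if "t $ p \<noteq> 0"
    proof -
      have "\<forall>s. axis (p s) 1 \<in> V_part k (f s)"
        using * that by (auto simp: V_part_iff axis_def split: if_splits)
      then show ?thesis unfolding axis_eq_pure_tensor by blast
    qed
    then show "(t $ p) *s axis p 1 \<in> vec.span {pure_tensor w | w. \<forall>s. w s \<in> V_part k (f s)}"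
    proof (cases "t $ p = 0")
      case True
      then show ?thesis by (simp add: vec.span_zero)
    qed (auto intro: vec.span_scale vec.span_base)
  qed
  then show "t \<in> G k f" by (simp add: basis_expansion)
qed

lemma endos_eqI:
  assumes "S \<in> endos" "T \<in> endos" "\<And>p. S (axis p 1) = T (axis p 1)"
  shows "S = T"
proof
  fix t
  have "S (\<Sum>p\<in>UNIV. (t $ p) *s axis p 1) = T (\<Sum>p\<in>UNIV. (t $ p) *s axis p 1)"
    by (simp add: endosD[OF assms(1)] endosD[OF assms(2)] assms(3))
  then show "S t = T t" by (simp add: basis_expansion)
qed

lemma gl_act:
  fixes x :: "complex ^ 'n ^ 'n::finite"
  shows gl_act_endos: "(gl_act x :: ('d::finite, 'n) tensor \<Rightarrow> _) \<in> endos"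
    and gl_act_pure: "gl_act x (pure_tensor w) = pure_tensor (\<lambda>s::'d. x *v w s)"
    and gl_act_coord: "gl_act x t $ p = (\<Sum>q\<in>UNIV. (\<Prod>s::'d\<in>UNIV. x $ p s $ q s) * t $ q)"
proof -
  let ?P = "\<lambda>T :: ('d, 'n) tensor \<Rightarrow> ('d, 'n) tensor.
    T \<in> endos \<and> (\<forall>w. T (pure_tensor w) = pure_tensor (\<lambda>s. x *v w s))"
  define T :: "('d, 'n) tensor \<Rightarrow> ('d, 'n) tensor"
    where "T t = (\<chi> p. \<Sum>q\<in>UNIV. (\<Prod>s\<in>UNIV. x $ p s $ q s) * t $ q)" for t
  have T: "?P T"
  proof (intro conjI allI)
    show "T \<in> endos"
      by (rule endosI) (simp_all add: T_def vec_eq_iff sum.distrib algebra_simps sum_distrib_left)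
    fix w :: "'d \<Rightarrow> complex ^ 'n"
    have "(\<Sum>q\<in>UNIV. (\<Prod>s\<in>UNIV. x $ p s $ q s) * (\<Prod>s\<in>UNIV. w s $ q s)) =
        (\<Prod>s\<in>UNIV. \<Sum>j\<in>UNIV. x $ p s $ j * w s $ j)" for p :: "'d \<Rightarrow> 'n"
      using prod_sum_PiE[of UNIV "\<lambda>_. UNIV" "\<lambda>s j. x $ p s $ j * w s $ j"]
      by (simp add: prod.distrib PiE_UNIV_domain)
    then show "T (pure_tensor w) = pure_tensor (\<lambda>s. x *v w s)"
      by (simp add: T_def pure_tensor_def vec_eq_iff matrix_vector_mult_def)
  qed
  have "?P (gl_act x)"
    unfolding gl_act_def
  proof (rule theI[of ?P, OF T])
    fix S assume "?P S"
    with T show "S = T" by (auto intro!: endos_eqI simp: axis_eq_pure_tensor)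
  qed
  moreover from this have "gl_act x = T"
    using T by (auto intro!: endos_eqI simp: axis_eq_pure_tensor)
  ultimately show "(gl_act x :: ('d, 'n) tensor \<Rightarrow> _) \<in> endos"
    "gl_act x (pure_tensor w) = pure_tensor (\<lambda>s. x *v w s)"
    "gl_act x t $ p = (\<Sum>q\<in>UNIV. (\<Prod>s\<in>UNIV. x $ p s $ q s) * t $ q)"
    by (simp_all add: T_def)
qed

lemma mor_act:
  fixes k :: "'l::{finite,linorder} \<Rightarrow> nat"
  assumes k: "(\<Sum>i\<in>UNIV. k i) = CARD('n::{finite,linorder})"
    and "bij \<sigma>"
  shows mor_act_endos: "(mor_act k (f, \<sigma>, g) :: ('d::finite, 'n) tensor \<Rightarrow> _) \<in> endos"
    and mor_act_pure: "(\<And>s. w s \<in> V_part k (f s)) \<Longrightarrow>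
      mor_act k (f, \<sigma>, g) (pure_tensor w :: ('d, 'n) tensor) = pure_tensor (\<lambda>s. w (inv \<sigma> s))"
    and mor_act_zero: "f' \<noteq> f \<Longrightarrow> t \<in> G k f' \<Longrightarrow>
      mor_act k (f, \<sigma>, g) (t :: ('d, 'n) tensor) = 0"
    and mor_act_coord: "mor_act k (f, \<sigma>, g) (t :: ('d, 'n) tensor) $ p =
      (if \<forall>s. p (\<sigma> s) \<in> block k (f s) then t $ (p \<circ> \<sigma>) else 0)"
proof -
  let ?P = "\<lambda>T :: ('d, 'n) tensor \<Rightarrow> ('d, 'n) tensor. T \<in> endos \<and>
     (\<forall>w. (\<forall>s. w s \<in> V_part k (f s)) \<longrightarrow> T (pure_tensor w) = pure_tensor (\<lambda>s. w (inv \<sigma> s))) \<and>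
     (\<forall>f'. f' \<noteq> f \<longrightarrow> (\<forall>t\<in>G k f'. T t = 0))"
  have inv: "inv \<sigma> (\<sigma> s) = s" for s
    using \<open>bij \<sigma>\<close> by (simp add: bij_is_inj)
  define T :: "('d, 'n) tensor \<Rightarrow> ('d, 'n) tensor" where
    "T t = (\<chi> p. if \<forall>s. p (\<sigma> s) \<in> block k (f s) then t $ (p \<circ> \<sigma>) else 0)" for t
  have T: "?P T"
  proof (intro conjI allI impI ballI)
    show "T \<in> endos"
      by (rule endosI) (simp_all add: T_def vec_eq_iff)
  next
    fix w :: "'d \<Rightarrow> complex ^ 'n::{finite,linorder}"
    assume w: "\<forall>s. w s \<in> V_part k (f s)"
    show "T (pure_tensor w) = pure_tensor (\<lambda>s. w (inv \<sigma> s))"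
    proof (unfold vec_eq_iff, rule)
      fix p :: "'d \<Rightarrow> 'n"
      have eq: "pure_tensor (\<lambda>s. w (inv \<sigma> s)) $ p = (\<Prod>s\<in>UNIV. w s $ p (\<sigma> s))"
        using prod.reindex_bij_betw[OF \<open>bij \<sigma>\<close>, of "\<lambda>s. w (inv \<sigma> s) $ p s"]
        by (simp add: pure_tensor_def inv)
      show "T (pure_tensor w) $ p = pure_tensor (\<lambda>s. w (inv \<sigma> s)) $ p"
      proof (cases "\<forall>s. p (\<sigma> s) \<in> block k (f s)")
        case True
        then show ?thesis unfolding eq by (simp add: T_def pure_tensor_def)
      next
        case False
        then obtain s where "p (\<sigma> s) \<notin> block k (f s)" by auto
        then have "w s $ p (\<sigma> s) = 0" using w by (auto simp: V_part_iff)
        then have "(\<Prod>s\<in>UNIV. w s $ p (\<sigma> s)) = 0" by (auto intro!: prod_zero)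
        then show ?thesis unfolding eq using False by (auto simp: T_def)
      qed
    qed
  next
    fix f' and t :: "('d, 'n) tensor"
    assume f': "f' \<noteq> f" and t: "t \<in> G k f'"
    have "t $ (p \<circ> \<sigma>) = 0" if "\<forall>s. p (\<sigma> s) \<in> block k (f s)" for p :: "'d \<Rightarrow> 'n"
    proof (rule ccontr)
      assume "t $ (p \<circ> \<sigma>) \<noteq> 0"
      then have "\<forall>s. p (\<sigma> s) \<in> block k (f' s)" using t by (auto simp: G_iff)
      then have "f' s = f s" for s using that ex1_block[OF k, of "p (\<sigma> s)"] by blast
      then have "f' = f" by blast
      then show False using f' by simp
    qed
    then show "T t = 0" by (simp add: T_def vec_eq_iff)
  qed
  have uniq: "S = T" if S: "?P S" for S
  proof (rule endos_eqI)
    fix p :: "'d \<Rightarrow> 'n"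
    define f' where "f' s = (THE i. p s \<in> block k i)" for s
    have f': "p s \<in> block k (f' s)" for s
      unfolding f'_def by (rule theI') (rule ex1_block[OF k])
    show "S (axis p 1) = T (axis p 1)"
    proof (cases "f' = f")
      case True
      then have "\<forall>s. axis (p s) 1 \<in> V_part k (f s)"
        using f' by (auto simp: V_part_iff axis_def)
      then show ?thesis using S T by (simp add: axis_eq_pure_tensor)
    next
      case False
      have "axis p 1 \<in> G k f'" using f' by (auto simp: G_iff axis_def)
      then show ?thesis using False S T by simp
    qed
  qed (use S T in auto)
  have P: "?P (mor_act k (f, \<sigma>, g))"
    unfolding mor_act.simps by (rule theI[of ?P, OF T uniq])
  then have eq: "mor_act k (f, \<sigma>, g) = T" by (rule uniq)
  show "(mor_act k (f, \<sigma>, g) :: ('d, 'n) tensor \<Rightarrow> _) \<in> endos"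
    using P by blast
  show "(\<And>s. w s \<in> V_part k (f s)) \<Longrightarrow>
      mor_act k (f, \<sigma>, g) (pure_tensor w :: ('d, 'n) tensor) = pure_tensor (\<lambda>s. w (inv \<sigma> s))"
    using P by blast
  show "f' \<noteq> f \<Longrightarrow> t \<in> G k f' \<Longrightarrow> mor_act k (f, \<sigma>, g) (t :: ('d, 'n) tensor) = 0"
    using P by blast
  show "mor_act k (f, \<sigma>, g) (t :: ('d, 'n) tensor) $ p =
      (if \<forall>s. p (\<sigma> s) \<in> block k (f s) then t $ (p \<circ> \<sigma>) else 0)"
    unfolding eq by (simp add: T_def)
qed

lemma lin_ext_conv:
  assumes a: "a \<in> free_space X" and b: "b \<in> free_space X"
    and \<rho>: "\<And>x. x \<in> X \<Longrightarrow> \<rho> x \<in> endos"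
    and m: "\<And>x y t. x \<in> X \<Longrightarrow> y \<in> X \<Longrightarrow>
      \<rho> x (\<rho> y t) = (case m x y of None \<Rightarrow> 0 | Some z \<Rightarrow> \<rho> z t)"
  shows "lin_ext \<rho> (conv m a b) = lin_ext \<rho> a \<circ> lin_ext \<rho> b"
proof
  fix t
  let ?A = "{x. a x \<noteq> 0}" and ?B = "{y. b y \<noteq> 0}"
  let ?M = "\<lambda>z. {(x, y). a x \<noteq> 0 \<and> b y \<noteq> 0 \<and> m x y = Some z}"
  let ?D = "{(x, y). a x \<noteq> 0 \<and> b y \<noteq> 0 \<and> m x y \<noteq> None}"
  let ?g = "\<lambda>(x, y). the (m x y)"
  have fin: "finite ?A" "finite ?B" and sub: "?A \<subseteq> X" "?B \<subseteq> X"
    using a b by (auto simp: free_space_def)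
  have D: "?D \<subseteq> ?A \<times> ?B" by auto
  have finD: "finite ?D" using finite_subset[OF D] fin by auto
  let ?Z = "?g ` ?D"
  have M: "?M z = {u \<in> ?D. ?g u = z}" for z by auto
  have "{z. conv m a b z \<noteq> 0} \<subseteq> ?Z"
  proof (rule ccontr)
    assume "\<not> {z. conv m a b z \<noteq> 0} \<subseteq> ?Z"
    then obtain z where z: "conv m a b z \<noteq> 0" "z \<notin> ?Z" by blast
    have "?M z = {}" unfolding M using z(2) by blast
    then show False using z(1) by (simp only: conv_def sum.empty)
  qed
  then have "lin_ext \<rho> (conv m a b) t = (\<Sum>z\<in>?Z. conv m a b z *s \<rho> z t)"
    unfolding lin_ext_def using finD by (intro sum.mono_neutral_left) auto
  also have "\<dots> = (\<Sum>z\<in>?Z. \<Sum>u\<in>{u\<in>?D. ?g u = z}. (a (fst u) * b (snd u)) *s \<rho> (?g u) t)"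
    unfolding conv_def M by (simp add: vec.scale_sum_left case_prod_beta)
  also have "\<dots> = (\<Sum>u\<in>?D. (a (fst u) * b (snd u)) *s \<rho> (?g u) t)"
    by (rule sum.image_gen[OF finD, symmetric])
  also have "\<dots> = (\<Sum>u\<in>?D. (a (fst u) * b (snd u)) *s \<rho> (fst u) (\<rho> (snd u) t))"
  proof (rule sum.cong[OF refl])
    fix u assume u: "u \<in> ?D"
    then have "fst u \<in> X" "snd u \<in> X" using sub by auto
    then show "(a (fst u) * b (snd u)) *s \<rho> (?g u) t =
        (a (fst u) * b (snd u)) *s \<rho> (fst u) (\<rho> (snd u) t)"
      using u by (auto simp: m)
  qed
  also have "\<dots> = (\<Sum>u\<in>?A \<times> ?B. (a (fst u) * b (snd u)) *s \<rho> (fst u) (\<rho> (snd u) t))"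
  proof (rule sum.mono_neutral_left[OF _ D])
    show "finite (?A \<times> ?B)" using fin by simp
    show "\<forall>u\<in>?A \<times> ?B - ?D. (a (fst u) * b (snd u)) *s \<rho> (fst u) (\<rho> (snd u) t) = 0"
    proof
      fix u assume u: "u \<in> ?A \<times> ?B - ?D"
      then have "fst u \<in> X" "snd u \<in> X" "m (fst u) (snd u) = None" using sub by auto
      then show "(a (fst u) * b (snd u)) *s \<rho> (fst u) (\<rho> (snd u) t) = 0" by (simp add: m)
    qed
  qed
  also have "\<dots> = (\<Sum>x\<in>?A. \<Sum>y\<in>?B. (a x * b y) *s \<rho> x (\<rho> y t))"
    by (simp add: sum.cartesian_product case_prod_beta)
  also have "\<dots> = (\<Sum>x\<in>?A. a x *s \<rho> x (\<Sum>y\<in>?B. b y *s \<rho> y t))"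
  proof (rule sum.cong[OF refl])
    fix x assume "x \<in> ?A"
    then have "\<rho> x \<in> endos" using sub \<rho> by auto
    then show "(\<Sum>y\<in>?B. (a x * b y) *s \<rho> x (\<rho> y t)) = a x *s \<rho> x (\<Sum>y\<in>?B. b y *s \<rho> y t)"
      by (simp add: endosD vec.scale_sum_right)
  qed
  finally show "lin_ext \<rho> (conv m a b) t = (lin_ext \<rho> a \<circ> lin_ext \<rho> b) t"
    by (simp add: lin_ext_def)
qed

lemma A_module:
  fixes k :: "'l::{finite,linorder} \<Rightarrow> nat" and a b :: "('d::finite, 'l) mor \<Rightarrow> complex"
  assumes k: "(\<Sum>i\<in>UNIV. k i) = CARD('n::{finite,linorder})"
    and "a \<in> free_space Mor" "b \<in> free_space Mor"
  shows "(lin_ext (mor_act k) (conv mor_comp a b) :: ('d, 'n) tensor \<Rightarrow> _) =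
    lin_ext (mor_act k) a \<circ> lin_ext (mor_act k) b"
proof (rule lin_ext_conv[OF assms(2,3)])
  fix x :: "('d, 'l) mor" assume "x \<in> Mor"
  then show "(mor_act k x :: ('d, 'n) tensor \<Rightarrow> _) \<in> endos"
    by (auto simp: Mor_def intro: mor_act_endos[OF k])
next
  fix x y :: "('d, 'l) mor" and t :: "('d, 'n) tensor"
  assume "x \<in> Mor" "y \<in> Mor"
  then obtain g' \<tau> h f \<sigma> g where x: "x = (g', \<tau>, h)" "bij \<tau>" "h \<circ> \<tau> = g'"
    and y: "y = (f, \<sigma>, g)" "bij \<sigma>" "g \<circ> \<sigma> = f"
    by (auto simp: Mor_def)
  have bij: "bij (\<tau> \<circ> \<sigma>)" using x y by (simp add: bij_comp)
  have f: "f s = g (\<sigma> s)" for s using y by auto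
  have all: "(\<forall>s. Q (\<sigma> s)) \<longleftrightarrow> (\<forall>s. Q s)" for Q using \<open>bij \<sigma>\<close> by (metis bij_pointE)
  note c = mor_act_coord[OF k]
  show "mor_act k x (mor_act k y t) =
      (case mor_comp x y of None \<Rightarrow> 0 | Some z \<Rightarrow> mor_act k z t)"
  proof (cases "g' = g")
    case True
    then show ?thesis
      using all[of "\<lambda>s. p (\<tau> s) \<in> block k (g s)" for p]
      by (auto simp: vec_eq_iff x(1) y(1) c[OF x(2)] c[OF y(2)] c[OF bij] f o_assoc)
  next
    case False
    have "\<not> ((\<forall>s. p (\<tau> s) \<in> block k (g' s)) \<and> (\<forall>s. p (\<tau> (\<sigma> s)) \<in> block k (f s)))"
      for p :: "'d \<Rightarrow> 'n"
      using all[of "\<lambda>s. p (\<tau> s) \<in> block k (g s)"] False ex1_block[OF k] unfolding f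
      by (metis ext)
    then show ?thesis using False
      by (auto simp: vec_eq_iff x(1) y(1) c[OF x(2)] c[OF y(2)])
  qed
qed

lemma GL_mult_closed: "x \<in> GL k \<Longrightarrow> y \<in> GL k \<Longrightarrow> (\<Sum>i\<in>UNIV. k i) = CARD('n) \<Longrightarrow>
  x ** y \<in> GL k" for x y :: "complex ^ 'n::{finite,linorder} ^ 'n::{finite,linorder}"
proof -
  assume x: "x \<in> GL k" and y: "y \<in> GL k" and k: "(\<Sum>i\<in>UNIV. k i) = CARD('n)"
  have "\<exists>i. p \<in> block k i \<and> q \<in> block k i" if nz: "(x ** y) $ p $ q \<noteq> 0" for p q
  proof -
    from nz obtain r where "x $ p $ r \<noteq> 0" "y $ r $ q \<noteq> 0"
      by (auto simp: matrix_matrix_mult_def elim!: sum.not_neutral_contains_not_neutral)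
    then show ?thesis using x y ex1_block[OF k, of r] unfolding GL_def by blast
  qed
  then show ?thesis using x y by (auto simp: GL_def invertible_mult)
qed

lemma GL_module:
  fixes a b :: "complex ^ 'n::{finite,linorder} ^ 'n::{finite,linorder} \<Rightarrow> complex"
  assumes "a \<in> free_space (GL k)" "b \<in> free_space (GL k)"
  shows "(lin_ext gl_act (conv (\<lambda>x y. Some (x ** y)) a b) :: ('d::finite, 'n) tensor \<Rightarrow> _) =
    lin_ext gl_act a \<circ> lin_ext gl_act b"
proof (rule lin_ext_conv[OF assms gl_act_endos])
  fix x y :: "complex ^ 'n::{finite,linorder} ^ 'n::{finite,linorder}" and t :: "('d, 'n) tensor"
  have "(gl_act x \<circ> gl_act y :: ('d, 'n) tensor \<Rightarrow> _) = gl_act (x ** y)"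
  proof (rule endos_eqI)
    show "(gl_act x \<circ> gl_act y :: ('d, 'n) tensor \<Rightarrow> _) \<in> endos"
      by (rule endosI) (simp_all add: endosD[OF gl_act_endos])
  qed (simp_all add: gl_act_endos axis_eq_pure_tensor gl_act_pure matrix_vector_mul_assoc)
  then show "gl_act x (gl_act y t) =
      (case Some (x ** y) of None \<Rightarrow> 0 | Some z \<Rightarrow> gl_act z t)"
    by (simp add: fun_eq_iff)
qed

end

theory Submission
  imports Defs
begin

text \<open>
  Both actions commute, so it remains to prove two inclusions. An operator commuting with \<open>A\<close> has a
  matrix that is supported on pairs of index maps with the same coloring and is invariant under
  simultaneous permutations; polarization writes it as a combination of \<open>y \<otimes> \<dots> \<otimes> y\<close>, where the
  freedom to add a large multiple of the identity to \<open>y\<close> makes all \<open>y\<close> invertible. Conversely,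
  the image of \<open>A\<close> is closed under adjoints, hence equals its own bicommutant.
\<close>

section \<open>Linear extensions of families of operators\<close>

text \<open>The main tool for membership in \<open>A_image\<close> and \<open>GL_image\<close>. The
  \<open>x i\<close> may repeat, so coefficients are added up over each fibre of \<open>x\<close> to
  obtain an element of the free space.\<close>

lemma lin_ext_combination:
  assumes "finite I" "\<And>i. i \<in> I \<Longrightarrow> x i \<in> X"
  shows "(\<lambda>t. \<Sum>i\<in>I. c i *s \<rho> (x i) t) \<in> lin_ext \<rho> ` free_space X"
proof (rule image_eqI)
  define a where "a z = (\<Sum>i\<in>{i\<in>I. x i = z}. c i)" for z
  have sub: "{z. a z \<noteq> 0} \<subseteq> x ` I"
    unfolding a_def by (auto elim: sum.not_neutral_contains_not_neutral)
  then show "a \<in> free_space X"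
    using assms by (auto simp: free_space_def intro: finite_subset)
  show "(\<lambda>t. \<Sum>i\<in>I. c i *s \<rho> (x i) t) = lin_ext \<rho> a"
  proof
    fix t
    have "(\<Sum>i\<in>I. c i *s \<rho> (x i) t) = (\<Sum>z\<in>x ` I. \<Sum>i\<in>{i\<in>I. x i = z}. c i *s \<rho> (x i) t)"
      using assms(1) by (rule sum.image_gen)
    also have "\<dots> = (\<Sum>z\<in>x ` I. a z *s \<rho> z t)"
      by (simp add: a_def vec.scale_sum_left)
    also have "\<dots> = lin_ext \<rho> a t"
      unfolding lin_ext_def using assms(1) sub by (intro sum.mono_neutral_right) auto
    finally show "(\<Sum>i\<in>I. c i *s \<rho> (x i) t) = lin_ext \<rho> a t" .
  qed
qed

lemma lin_ext_endos:
  assumes "a \<in> free_space X" "\<And>x. x \<in> X \<Longrightarrow> \<rho> x \<in> endos"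
  shows "lin_ext \<rho> a \<in> endos"
proof (rule endosI)
  have \<rho>: "\<rho> x \<in> endos" if "a x \<noteq> 0" for x
    using assms that by (auto simp: free_space_def)
  show "lin_ext \<rho> a (s + t) = lin_ext \<rho> a s + lin_ext \<rho> a t" for s t
    by (simp add: lin_ext_def endosD[OF \<rho>] vec.scale_right_distrib sum.distrib)
  show "lin_ext \<rho> a (c *s t) = c *s lin_ext \<rho> a t" for c t
    by (simp add: lin_ext_def endosD[OF \<rho>] vec.scale_sum_right mult.commute)
qed

lemma lin_ext_commute:
  assumes U: "U \<in> endos" and a: "a \<in> free_space X"
    and comm: "\<And>x. x \<in> X \<Longrightarrow> U \<circ> \<rho> x = \<rho> x \<circ> U"
  shows "U \<circ> lin_ext \<rho> a = lin_ext \<rho> a \<circ> U"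
proof
  fix t
  have "U (\<rho> x t) = \<rho> x (U t)" if "a x \<noteq> 0" for x
    using comm[of x] a that by (auto simp: free_space_def fun_eq_iff)
  then show "(U \<circ> lin_ext \<rho> a) t = (lin_ext \<rho> a \<circ> U) t"
    by (simp add: lin_ext_def endosD[OF U])
qed

section \<open>The bicommutant theorem in finite dimension\<close>

text \<open>This is left multiplication by \<open>U\<close> on operators stored as families of
  columns: \<open>col_map U (cols V) = cols (U \<circ> V)\<close>.\<close>

definition col_map :: "(complex ^ 'a \<Rightarrow> complex ^ 'a) \<Rightarrow> complex ^ 'a ^ 'a \<Rightarrow> complex ^ 'a ^ 'a"
  where "col_map U Z = (\<chi> y. U (Z $ y))"

text \<open>Storing an operator by its columns places it in a Euclidean space whose inner product is
  the real part of the trace form, so that orthogonal projection becomes available.\<close>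

definition cols :: "(complex ^ 'a \<Rightarrow> complex ^ 'a) \<Rightarrow> complex ^ 'a ^ 'a"
  where "cols U = (\<chi> y. U (axis y 1))"

text \<open>The inner product on \<open>complex ^ 'a\<close> is the real part of the Hermitian one,
  so multiplication by \<open>c\<close> has adjoint multiplication by \<open>cnj c\<close>.\<close>

lemma inner_cscale_left:
  fixes h h' :: "complex ^ 'a::finite"
  shows "(c *s h) \<bullet> h' = h \<bullet> (cnj c *s h')"
  by (simp add: inner_vec_def inner_complex_def algebra_simps)

lemma axis_sum_expansion:
  fixes Z :: "'b::comm_monoid_add ^ 'a::finite"
  shows "(\<Sum>y\<in>UNIV. axis y (Z $ y)) = Z"
  by (simp add: vec_eq_iff axis_def)

text \<open>
  With respect to the columns, the orthogonal projection \<open>Q\<close> onto the subspace \<open>cols ` M\<close> of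
  \<open>End(H)\<close> is a matrix of operators on \<open>H\<close>. As \<open>M\<close> is closed under adjoints, \<open>Q\<close> commutes
  with left multiplication by \<open>M\<close>, so all these operators lie in the centralizer of \<open>M\<close>. An
  element \<open>T\<close> of the bicommutant then commutes with \<open>Q\<close>, whence \<open>T = T Q(1) = Q(T) \<in> M\<close>.
\<close>

theorem bicommutant:
  fixes M :: "(complex ^ 'a::finite \<Rightarrow> complex ^ 'a) set"
  assumes M: "M \<subseteq> endos" and one: "id \<in> M"
    and add: "\<And>U V. U \<in> M \<Longrightarrow> V \<in> M \<Longrightarrow> (\<lambda>t. U t + V t) \<in> M"
    and scale: "\<And>c U. U \<in> M \<Longrightarrow> (\<lambda>t. c *s U t) \<in> M"
    and comp: "\<And>U V. U \<in> M \<Longrightarrow> V \<in> M \<Longrightarrow> U \<circ> V \<in> M"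
    and adj: "\<And>U. U \<in> M \<Longrightarrow> \<exists>V\<in>M. \<forall>h h'. U h \<bullet> h' = h \<bullet> V h'"
  shows "centralizer (centralizer M) = M"
proof
  show "M \<subseteq> centralizer (centralizer M)"
    using M by (auto simp: centralizer_def)
  show "centralizer (centralizer M) \<subseteq> M"
  proof
    fix T assume T: "T \<in> centralizer (centralizer M)"
    then have Te: "T \<in> endos" by (simp add: centralizer_def)
    let ?W = "cols ` M"
    have col_map_cols: "col_map U (cols V) = cols (U \<circ> V)" for U V :: "complex ^ 'a \<Rightarrow> complex ^ 'a"
      by (simp add: col_map_def cols_def)
    have col_map_W: "col_map U w \<in> ?W" if "U \<in> M" "w \<in> ?W" for U w
      using that comp by (auto simp: col_map_cols)
    \<comment> \<open>Subspaces are real here, matching the real inner product. Complex linearity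
      returns later through the scalar operators contained in \<open>M\<close>.\<close>
    have W: "subspace ?W"
    proof (unfold subspace_def, intro conjI ballI allI)
      have "cols (\<lambda>t. 0 *s id t) \<in> ?W" by (intro imageI scale one)
      then show "0 \<in> ?W" by (simp add: cols_def zero_vec_def)
      fix x y assume "x \<in> ?W" "y \<in> ?W"
      then obtain U V where "U \<in> M" "V \<in> M" "x = cols U" "y = cols V" by auto
      moreover have "cols U + cols V = cols (\<lambda>t. U t + V t)"
        by (simp add: cols_def vec_eq_iff)
      ultimately show "x + y \<in> ?W" using add by auto
    next
      fix r :: real and x assume "x \<in> ?W"
      then obtain U where "U \<in> M" "x = cols U" by auto
      moreover have "r *\<^sub>R cols U = cols (\<lambda>t. of_real r *s U t)"
        by (simp add: cols_def vec_eq_iff scaleR_conv_of_real[where 'a=complex])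
      ultimately show "r *\<^sub>R x \<in> ?W" using scale by auto
    qed
    define Q where "Q Z = (SOME w. w \<in> ?W \<and> (\<forall>v\<in>?W. (Z - w) \<bullet> v = 0))" for Z
    have Q: "Q Z \<in> ?W" "\<And>v. v \<in> ?W \<Longrightarrow> (Z - Q Z) \<bullet> v = 0" for Z
    proof -
      obtain y z where "y \<in> span ?W" "\<And>w. w \<in> span ?W \<Longrightarrow> orthogonal z w" "Z = y + z"
        using orthogonal_subspace_decomp_exists[of ?W Z] by blast
      then have "\<exists>w. w \<in> ?W \<and> (\<forall>v\<in>?W. (Z - w) \<bullet> v = 0)"
        using span_eq_iff[THEN iffD2, OF W] by (intro exI[of _ y]) (auto simp: orthogonal_def)
      from someI_ex[OF this] show "Q Z \<in> ?W" "\<And>v. v \<in> ?W \<Longrightarrow> (Z - Q Z) \<bullet> v = 0"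
        unfolding Q_def by blast+
    qed
    \<comment> \<open>Both residuals \<open>Z - w\<close> and \<open>Z - Q Z\<close> are orthogonal
      to \<open>Q Z - w\<close>, which is therefore orthogonal to itself.\<close>
    have Q_eq: "Q Z = w" if w: "w \<in> ?W" "\<And>v. v \<in> ?W \<Longrightarrow> (Z - w) \<bullet> v = 0" for Z w
    proof -
      have d: "Q Z - w \<in> ?W" using Q(1) w(1) W by (simp add: subspace_diff)
      have "(Q Z - w) \<bullet> (Q Z - w) = (Z - w) \<bullet> (Q Z - w) - (Z - Q Z) \<bullet> (Q Z - w)"
        by (simp add: inner_diff_left)
      also have "\<dots> = 0" using w(2)[OF d] Q(2)[OF d] by simp
      finally show ?thesis by simp
    qed
    have Q_add: "Q (Y + Z) = Q Y + Q Z" for Y Z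
    proof (rule Q_eq)
      show "Q Y + Q Z \<in> ?W" using Q(1) W by (simp add: subspace_add)
      fix v assume "v \<in> ?W"
      then show "(Y + Z - (Q Y + Q Z)) \<bullet> v = 0"
        using Q(2)[of v Y] Q(2)[of v Z] by (simp add: inner_diff_left inner_add_left)
    qed
    have Q_0: "Q 0 = 0" using Q_add[of 0 0] by simp
    have Q_sum: "Q (\<Sum>y\<in>A. h y) = (\<Sum>y\<in>A. Q (h y))" for h :: "'a \<Rightarrow> _" and A
      by (induction A rule: infinite_finite_induct) (simp_all add: Q_0 Q_add)
    \<comment> \<open>The adjoint \<open>V\<close> preserves \<open>?W\<close>, so \<open>U\<close>
      preserves the orthogonal complement of \<open>?W\<close> as well as \<open>?W\<close>
      itself.\<close>
    have Q_col_map: "Q (col_map U Z) = col_map U (Q Z)" if U: "U \<in> M" for U Z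
    proof (rule Q_eq)
      show "col_map U (Q Z) \<in> ?W" using col_map_W U Q(1) by simp
      fix v assume v: "v \<in> ?W"
      obtain V where V: "V \<in> M" "\<And>h h'. U h \<bullet> h' = h \<bullet> V h'" using adj U by blast
      have "(col_map U Z - col_map U (Q Z)) \<bullet> v = (Z - Q Z) \<bullet> col_map V v"
        by (simp add: inner_vec_def[where 'a="complex ^ 'a"] col_map_def inner_diff_left V(2))
      also have "\<dots> = 0" using Q(2) col_map_W V(1) v by simp
      finally show "(col_map U Z - col_map U (Q Z)) \<bullet> v = 0" .
    qed
    define q where "q y y' h = Q (axis y' h) $ y" for y y' :: 'a and h :: "complex ^ 'a"
    have axis: "axis y (U h) = col_map U (axis y h)" if "U \<in> endos"
      for y h and U :: "complex ^ 'a \<Rightarrow> complex ^ 'a"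
      using endosD(2)[OF that, of 0] by (simp add: col_map_def vec_eq_iff axis_def)
    have q_comm: "q y y' (U h) = U (q y y' h)" if U: "U \<in> M" for y y' U h
    proof -
      have "axis y' (U h) = col_map U (axis y' h)" using axis U M by auto
      then have "q y y' (U h) = col_map U (Q (axis y' h)) $ y"
        by (simp only: q_def Q_col_map[OF U])
      then show ?thesis by (simp add: q_def col_map_def)
    qed
    have "q y y' \<in> centralizer M" for y y'
    proof -
      have "q y y' \<in> endos"
      proof (rule endosI)
        show "q y y' (s + t) = q y y' s + q y y' t" for s t
        proof -
          have "axis y' (s + t) = axis y' s + axis y' t" by (simp add: vec_eq_iff axis_def)
          then show ?thesis by (simp add: q_def Q_add)
        qed
        \<comment> \<open>So far \<open>q y y'\<close> is only known to be additive. Multiplication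
          by \<open>c\<close> belongs to \<open>M\<close>, and \<open>q y y'\<close> commutes with
          \<open>M\<close>.\<close>
        show "q y y' (c *s t) = c *s q y y' t" for c t
          using q_comm[OF scale[OF one]] by simp
      qed
      then show ?thesis using q_comm by (auto simp: centralizer_def)
    qed
    then have q_T: "q y y' (T h) = T (q y y' h)" for y y' h
      using T by (auto simp: centralizer_def fun_eq_iff)
    have Q_q: "Q Z $ y = (\<Sum>y'\<in>UNIV. q y y' (Z $ y'))" for Z y
    proof -
      have "Q Z = (\<Sum>y'\<in>UNIV. Q (axis y' (Z $ y')))"
        unfolding Q_sum[symmetric] axis_sum_expansion ..
      then show ?thesis by (simp add: q_def)
    qed
    have "Q (col_map T (cols id)) = col_map T (Q (cols id))"
      by (simp add: vec_eq_iff[where 'a="complex ^ 'a"] Q_q col_map_def q_T endosD[OF Te])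
    moreover have "Q (cols id) = cols id" using one by (intro Q_eq) auto
    ultimately have "cols T = Q (cols T)" by (simp add: col_map_cols)
    then have "cols T \<in> ?W" using Q(1)[of "cols T"] by simp
    then obtain U where U: "U \<in> M" "cols T = cols U" by auto
    then have "T = U"
      using M Te by (intro endos_eqI) (auto simp: cols_def vec_eq_iff[where 'a="complex ^ 'a"])
    then show "T \<in> M" using U by simp
  qed
qed

section \<open>Polarization\<close>

text \<open>
  Expanding the products, a map \<open>h\<close> occurs with coefficient \<open>\<Prod>s. (1 - [s is not a value of h])\<close>,
  so only permutations survive; in particular the terms \<open>b\<close> drop out.
\<close>

lemma polarization:
  fixes b :: "'d::finite \<Rightarrow> 'c::comm_ring_1" and u :: "'d \<Rightarrow> 'd \<Rightarrow> 'c"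
  shows "(\<Sum>S\<in>UNIV. (- 1) ^ card (- S) * (\<Prod>j\<in>UNIV. b j + (\<Sum>s\<in>S. u s j))) =
    (\<Sum>\<sigma> | bij \<sigma>. \<Prod>j\<in>UNIV. u (\<sigma> j) j)"
proof -
  \<comment> \<open>A choice of one summand in each factor is a map \<open>h\<close>, where
    \<open>None\<close> selects \<open>b j\<close> and \<open>Some s\<close> selects
    \<open>u s j\<close>.\<close>
  define w where "w z j = (case z of None \<Rightarrow> b j | Some s \<Rightarrow> u s j)" for z j
  let ?H = "\<lambda>S. {h :: 'd \<Rightarrow> 'd option. \<forall>j. h j \<in> insert None (Some ` S)}"
  have expand: "(\<Prod>j\<in>UNIV. b j + (\<Sum>s\<in>S. u s j)) = (\<Sum>h\<in>?H S. \<Prod>j\<in>UNIV. w (h j) j)" for S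
  proof -
    have "b j + (\<Sum>s\<in>S. u s j) = (\<Sum>z\<in>insert None (Some ` S). w z j)" for j
      by (subst sum.insert) (auto simp: w_def sum.reindex)
    then have "(\<Prod>j\<in>UNIV. b j + (\<Sum>s\<in>S. u s j)) =
        (\<Prod>j\<in>UNIV. \<Sum>z\<in>insert None (Some ` S). w z j)" by simp
    also have "\<dots> = (\<Sum>h\<in>PiE UNIV (\<lambda>_. insert None (Some ` S)). \<Prod>j\<in>UNIV. w (h j) j)"
      by (rule prod_sum_PiE) auto
    also have "PiE UNIV (\<lambda>_. insert None (Some ` S)) = ?H S" by (auto simp: PiE_UNIV_domain)
    finally show ?thesis .
  qed
  have coeff: "(\<Sum>S | h \<in> ?H S. (- 1) ^ card (- S)) = (if \<forall>s. Some s \<in> range h then 1 else 0 :: 'c)"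
    for h :: "'d \<Rightarrow> 'd option"
  proof -
    \<comment> \<open>When the product of \<open>1 + ?m s\<close> is expanded, the set
      \<open>- S\<close> collects the factors \<open>?m s\<close>. Their product is nonzero exactly
      if no \<open>Some s\<close> with \<open>s \<in> - S\<close> is a value of \<open>h\<close>,
      that is, if \<open>h \<in> ?H S\<close>.\<close>
    let ?m = "\<lambda>s. if Some s \<in> range h then 0 else - 1 :: 'c"
    have "(\<Prod>s\<in>UNIV. 1 + ?m s) = (\<Sum>S\<in>UNIV. \<Prod>s\<in>- S. ?m s)"
      by (subst prod_add) (simp_all add: Compl_eq_Diff_UNIV)
    also have "\<dots> = (\<Sum>S\<in>UNIV. if h \<in> ?H S then (- 1) ^ card (- S) else 0)"
    proof (rule sum.cong[OF refl])
      fix S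
      show "(\<Prod>s\<in>- S. ?m s) = (if h \<in> ?H S then (- 1) ^ card (- S) else 0)"
      proof (cases "h \<in> ?H S")
        case True
        then have "?m s = - 1" if "s \<in> - S" for s
          using that by (auto simp: image_iff) (metis image_iff insertE option.distinct(1) option.inject)
        then have "(\<Prod>s\<in>- S. ?m s) = (\<Prod>s\<in>- S. - 1)" by (rule prod.cong[OF refl])
        then show ?thesis using True by simp
      next
        case False
        then obtain j where "h j \<notin> insert None (Some ` S)" by auto
        then obtain s where s: "h j = Some s" "s \<in> - S" by (cases "h j") auto
        then have "?m s = 0" by (metis rangeI)
        then have "(\<Prod>s\<in>- S. ?m s) = 0" using s(2) by (intro prod_zero[OF finite]) blast
        then show ?thesis by (simp only: if_not_P[OF False])
      qed
    qed
    also have "\<dots> = (\<Sum>S | h \<in> ?H S. (- 1) ^ card (- S))"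
      by (simp add: sum.If_cases)
    finally have "(\<Sum>S | h \<in> ?H S. (- 1) ^ card (- S)) = (\<Prod>s\<in>UNIV. 1 + ?m s)" by simp
    also have "\<dots> = (if \<forall>s. Some s \<in> range h then 1 else 0)"
      by (auto intro!: prod.neutral prod_zero)
    finally show ?thesis .
  qed
  \<comment> \<open>By counting, a map on \<open>'d\<close> that hits every \<open>Some s\<close>
    has no room left for the value \<open>None\<close>, and is a permutation followed by
    \<open>Some\<close>.\<close>
  have surj: "{h :: 'd \<Rightarrow> 'd option. \<forall>s. Some s \<in> range h} = (\<lambda>\<sigma>. Some \<circ> \<sigma>) ` {\<sigma>. bij \<sigma>}"
  proof (intro equalityI subsetI)
    fix h :: "'d \<Rightarrow> 'd option" assume "h \<in> {h. \<forall>s. Some s \<in> range h}"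
    then have h: "range Some \<subseteq> range h" by auto
    have "card (range h) \<le> card (range (Some :: 'd \<Rightarrow> 'd option))"
      using card_image_le[of UNIV h] by (simp add: card_image)
    then have eq: "range Some = range h" using h by (intro card_seteq) auto
    then have "h j = Some (the (h j))" for j by (metis option.sel rangeE rangeI)
    then have h': "h = Some \<circ> (\<lambda>j. the (h j))" by auto
    then have "surj (\<lambda>j. the (h j))" using eq by (metis surj_def option.sel rangeE rangeI)
    then have "bij (\<lambda>j. the (h j))" by (simp add: finite_UNIV_surj_inj bij_def)
    then show "h \<in> (\<lambda>\<sigma>. Some \<circ> \<sigma>) ` {\<sigma>. bij \<sigma>}" using h' by blast
  next
    fix h assume "h \<in> (\<lambda>\<sigma>. Some \<circ> \<sigma>) ` {\<sigma> :: 'd \<Rightarrow> 'd. bij \<sigma>}"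
    then show "h \<in> {h. \<forall>s. Some s \<in> range h}"
      by (auto simp: image_iff) (metis bij_pointE)
  qed
  have "(\<Sum>S\<in>UNIV. (- 1) ^ card (- S) * (\<Prod>j\<in>UNIV. b j + (\<Sum>s\<in>S. u s j))) =
      (\<Sum>S\<in>UNIV. \<Sum>h | h \<in> UNIV \<and> h \<in> ?H S. (- 1) ^ card (- S) * (\<Prod>j\<in>UNIV. w (h j) j))"
    by (simp add: expand sum_distrib_left)
  also have "\<dots> = (\<Sum>h\<in>UNIV. \<Sum>S | S \<in> UNIV \<and> h \<in> ?H S. (- 1) ^ card (- S) * (\<Prod>j\<in>UNIV. w (h j) j))"
    by (rule sum.swap_restrict) simp_all
  also have "\<dots> = (\<Sum>h\<in>UNIV. (if \<forall>s. Some s \<in> range h then 1 else 0) * (\<Prod>j\<in>UNIV. w (h j) j))"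
    by (simp only: coeff[symmetric] sum_distrib_right UNIV_I simp_thms)
  also have "\<dots> = (\<Sum>h | \<forall>s. Some s \<in> range h. \<Prod>j\<in>UNIV. w (h j) j)"
    by (simp add: if_distrib[of "\<lambda>x. x * _"] sum.If_cases cong: if_cong)
  also have "\<dots> = (\<Sum>\<sigma> | bij \<sigma>. \<Prod>j\<in>UNIV. w ((Some \<circ> \<sigma>) j) j)"
    unfolding surj by (subst sum.reindex) (auto simp: inj_on_def fun_eq_iff)
  finally show ?thesis by (simp add: w_def)
qed

section \<open>Invertibility by diagonal dominance\<close>

text \<open>At a coordinate \<open>p\<close> where a nonzero kernel vector \<open>v\<close> has
  maximal modulus, \<open>r * v $ p\<close> would have to cancel a sum of strictly smaller
  modulus.\<close>

lemma invertible_if_row_dominant: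
  fixes x :: "complex ^ 'n::finite ^ 'n"
  assumes "\<And>p. (\<Sum>q\<in>UNIV. norm (x $ p $ q)) < r"
  shows "invertible (\<chi> p q. (if p = q then of_real r else 0) + x $ p $ q)"
    (is "invertible ?y")
proof -
  have "v = 0" if v: "?y *v v = 0" for v
  proof (rule ccontr)
    assume "v \<noteq> 0"
    define p where "p = (ARG_MAX (\<lambda>p. norm (v $ p)) p. p \<in> UNIV)"
    have p: "norm (v $ q) \<le> norm (v $ p)" for q
    proof -
      have "Max (range (\<lambda>p. norm (v $ p))) \<in> range (\<lambda>p. norm (v $ p))" by (intro Max_in) auto
      then obtain p' where "Max (range (\<lambda>p. norm (v $ p))) = norm (v $ p')"
        by (metis (no_types, lifting) imageE)
      then have "is_arg_max (\<lambda>p. norm (v $ p)) (\<lambda>p. p \<in> UNIV) p'"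
        by (auto simp: is_arg_max_linorder) (metis Max_ge finite_class.finite_UNIV finite_imageI rangeI)
      then have "is_arg_max (\<lambda>p. norm (v $ p)) (\<lambda>p. p \<in> UNIV) p"
        unfolding p_def arg_max_def by (rule someI)
      then show ?thesis by (auto simp: is_arg_max_linorder)
    qed
    have pos: "norm (v $ p) > 0" using p \<open>v \<noteq> 0\<close>
      by (auto simp: vec_eq_iff)
    have "of_real r * v $ p + (\<Sum>q\<in>UNIV. x $ p $ q * v $ q) = (?y *v v) $ p"
      by (simp add: matrix_vector_mult_def distrib_right sum.distrib if_distrib[of "\<lambda>a. a * _"] cong: if_cong)
    then have "of_real r * v $ p = - (\<Sum>q\<in>UNIV. x $ p $ q * v $ q)"
      by (simp add: v eq_neg_iff_add_eq_0)
    then have "norm (of_real r * v $ p) = norm (\<Sum>q\<in>UNIV. x $ p $ q * v $ q)" by simp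
    also have "\<dots> \<le> (\<Sum>q\<in>UNIV. norm (x $ p $ q) * norm (v $ p))"
      by (rule sum_norm_le) (simp add: norm_mult mult_left_mono p)
    also have "\<dots> = (\<Sum>q\<in>UNIV. norm (x $ p $ q)) * norm (v $ p)"
      by (simp add: sum_distrib_right)
    also have "\<dots> < r * norm (v $ p)"
      using assms pos by (intro mult_strict_right_mono) auto
    finally show False using mult_right_mono[OF abs_ge_self[of r], of "norm (v $ p)"]
      by (simp add: norm_mult)
  qed
  then show ?thesis
    by (simp add: invertible_left_inverse matrix_left_invertible_ker)
qed

section \<open>The two actions\<close>

lemma in_block_cong:
  fixes k :: "'l::{finite,linorder} \<Rightarrow> nat" and p q :: "'n::{finite,linorder}"
  assumes "(\<Sum>i\<in>UNIV. k i) = CARD('n)" "p \<in> block k i'" "q \<in> block k i'"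
  shows "p \<in> block k i \<longleftrightarrow> q \<in> block k i"
  using assms ex1_block[OF assms(1), of p] ex1_block[OF assms(1), of q] by blast

lemma gl_act_axis:
  "gl_act x (axis q 1) $ p = (\<Prod>s\<in>UNIV. x $ p s $ q s)"
  by (simp add: gl_act_coord axis_def if_distrib[of "\<lambda>a. _ * a"] cong: if_cong)

lemma bij_comp_right:
  assumes "bij \<sigma>" shows "bij (\<lambda>q. q \<circ> \<sigma>)"
proof (rule o_bij[where g="\<lambda>q. q \<circ> inv \<sigma>"])
  show "(\<lambda>q. q \<circ> inv \<sigma>) \<circ> (\<lambda>q. q \<circ> \<sigma>) = id" "(\<lambda>q. q \<circ> \<sigma>) \<circ> (\<lambda>q. q \<circ> inv \<sigma>) = id"
    using assms by (auto simp: fun_eq_iff bij_is_inj bij_is_surj surj_f_inv_f)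
qed

text \<open>Entries of \<open>x\<close> outside the blocks vanish, so only those \<open>q\<close>
  with the same coloring as \<open>p\<close> contribute. The source condition of the morphism can
  then be tested on \<open>p\<close> instead of \<open>q\<close>, and reindexing by
  \<open>\<sigma>\<close> finishes.\<close>

lemma mor_act_gl_act_commute:
  fixes k :: "'l::{finite,linorder} \<Rightarrow> nat"
    and x :: "complex ^ 'n::{finite,linorder} ^ 'n::{finite,linorder}"
  assumes k: "(\<Sum>i\<in>UNIV. k i) = CARD('n)" and m: "m \<in> Mor" and x: "x \<in> GL k"
  shows "mor_act k m \<circ> gl_act x = (gl_act x \<circ> mor_act k m :: ('d::finite, 'n) tensor \<Rightarrow> _)"
proof
  fix t :: "('d, 'n) tensor"
  obtain f \<sigma> g where m: "m = (f, \<sigma>, g)" "bij \<sigma>" using m by (auto simp: Mor_def)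
  note c = mor_act_coord[OF k m(2)]
  have "gl_act x (mor_act k m t) $ p = mor_act k m (gl_act x t) $ p" for p
  proof -
    let ?c = "\<lambda>q :: 'd \<Rightarrow> 'n. \<forall>s. q (\<sigma> s) \<in> block k (f s)"
    have "gl_act x (mor_act k m t) $ p =
        (\<Sum>q\<in>UNIV. (\<Prod>s\<in>UNIV. x $ p s $ q s) * (if ?c q then t $ (q \<circ> \<sigma>) else 0))"
      by (simp add: gl_act_coord m(1) c)
    also have "\<dots> = (\<Sum>q\<in>UNIV. if ?c p then (\<Prod>s\<in>UNIV. x $ p (\<sigma> s) $ q (\<sigma> s)) * t $ (q \<circ> \<sigma>) else 0)"
    proof (rule sum.cong[OF refl])
      fix q :: "'d \<Rightarrow> 'n"
      have eq: "(\<Prod>s\<in>UNIV. x $ p s $ q s) = (\<Prod>s\<in>UNIV. x $ p (\<sigma> s) $ q (\<sigma> s))"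
        using prod.reindex_bij_betw[OF m(2), of "\<lambda>s. x $ p s $ q s"] by simp
      show "(\<Prod>s\<in>UNIV. x $ p s $ q s) * (if ?c q then t $ (q \<circ> \<sigma>) else 0) =
          (if ?c p then (\<Prod>s\<in>UNIV. x $ p (\<sigma> s) $ q (\<sigma> s)) * t $ (q \<circ> \<sigma>) else 0)"
      proof (cases "\<exists>s. x $ p s $ q s = 0")
        case True
        then have "(\<Prod>s\<in>UNIV. x $ p s $ q s) = 0" by (auto intro: prod_zero)
        then show ?thesis using eq by simp
      next
        case False
        then have "\<exists>i. p s \<in> block k i \<and> q s \<in> block k i" for s using x by (auto simp: GL_def)
        then have "p s \<in> block k i \<longleftrightarrow> q s \<in> block k i" for s i
          using in_block_cong[OF k] by blast
        then show ?thesis using eq by simp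
      qed
    qed
    also have "\<dots> = (if ?c p then (\<Sum>q\<in>UNIV. (\<Prod>s\<in>UNIV. x $ p (\<sigma> s) $ (q \<circ> \<sigma>) s) * t $ (q \<circ> \<sigma>)) else 0)"
      by (cases "?c p") (simp_all only: if_True if_False sum.neutral_const comp_apply simp_thms)
    also have "(\<Sum>q\<in>UNIV. (\<Prod>s\<in>UNIV. x $ p (\<sigma> s) $ (q \<circ> \<sigma>) s) * t $ (q \<circ> \<sigma>)) =
        (\<Sum>q\<in>UNIV. (\<Prod>s\<in>UNIV. x $ p (\<sigma> s) $ q s) * t $ q)"
      by (rule sum.reindex_bij_betw[OF bij_comp_right[OF m(2)],
            of "\<lambda>q. (\<Prod>s\<in>UNIV. x $ p (\<sigma> s) $ q s) * t $ q"])
    finally show ?thesis by (simp add: gl_act_coord m(1) c)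
  qed
  then show "(mor_act k m \<circ> gl_act x) t = (gl_act x \<circ> mor_act k m) t"
    by (simp add: vec_eq_iff)
qed

section \<open>The image of \<open>A\<close> as an algebra closed under adjoints\<close>

text \<open>There are only finitely many morphisms, so arbitrary coefficient functions are allowed.
  This form makes closure under sums and scalar multiples immediate.\<close>

lemma A_image_eq:
  "A_image k = {T. \<exists>a. T = (\<lambda>t. \<Sum>m\<in>Mor. a m *s mor_act k m t)}"
proof (intro equalityI subsetI)
  fix T assume "T \<in> A_image k"
  then obtain a where a: "a \<in> free_space Mor" "T = lin_ext (mor_act k) a"
    by (auto simp: A_image_def)
  then have "T = (\<lambda>t. \<Sum>m\<in>Mor. a m *s mor_act k m t)"
    unfolding a(2) lin_ext_def by (intro ext sum.mono_neutral_left) (auto simp: free_space_def)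
  then show "T \<in> {T. \<exists>a. T = (\<lambda>t. \<Sum>m\<in>Mor. a m *s mor_act k m t)}" by blast
next
  fix T assume "T \<in> {T. \<exists>a. T = (\<lambda>t. \<Sum>m\<in>Mor. a m *s mor_act k m t)}"
  then obtain a where "T = (\<lambda>t. \<Sum>m\<in>Mor. a m *s mor_act k m t)" by blast
  then show "T \<in> A_image k"
    unfolding A_image_def by (simp only: lin_ext_combination[OF finite, of _ "\<lambda>m. m"])
qed

lemma mor_act_in_A_image: "m \<in> Mor \<Longrightarrow> mor_act k m \<in> A_image k"
  unfolding A_image_def
  using lin_ext_combination[of "{m}" "\<lambda>m. m" Mor "\<lambda>_. 1" "mor_act k"] by simp

fun mor_inv :: "('d, 'l) mor \<Rightarrow> ('d, 'l) mor" where
  "mor_inv (f, \<sigma>, g) = (g, inv \<sigma>, f)"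

lemma mor_inv_Mor: "m \<in> Mor \<Longrightarrow> mor_inv m \<in> Mor"
  by (auto simp: Mor_def bij_imp_bij_inv comp_assoc bij_is_surj surj_iff[THEN iffD1])

text \<open>A morphism maps the standard basis tensors of its source summand bijectively to those of
  its target summand and kills the others. It is thus a partial isometry, with adjoint given by the
  inverse morphism.\<close>

lemma inner_mor_act:
  fixes k :: "'l::{finite,linorder} \<Rightarrow> nat" and t t' :: "('d::finite, 'n::{finite,linorder}) tensor"
  assumes k: "(\<Sum>i\<in>UNIV. k i) = CARD('n)" and m: "m \<in> Mor"
  shows "mor_act k m t \<bullet> t' = t \<bullet> mor_act k (mor_inv m) t'"
proof -
  obtain f \<sigma> g where m: "m = (f, \<sigma>, g)" "bij \<sigma>" "f = g \<circ> \<sigma>" using m by (auto simp: Mor_def)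
  have inv: "bij (inv \<sigma>)" "inv \<sigma> (\<sigma> s) = s" "\<sigma> (inv \<sigma> s) = s" for s
    using m(2) by (auto simp: bij_imp_bij_inv bij_is_inj bij_is_surj surj_f_inv_f)
  have all: "(\<forall>s. p (inv \<sigma> s) \<in> block k (g s)) \<longleftrightarrow> (\<forall>s. p s \<in> block k (f s))"
    for p :: "'d \<Rightarrow> 'n"
    using inv m(3) by (metis comp_apply)
  have "mor_act k m t \<bullet> t' =
      (\<Sum>p\<in>UNIV. (if \<forall>s. (p \<circ> \<sigma>) s \<in> block k (f s) then t $ (p \<circ> \<sigma>) else 0) \<bullet> t' $ (p \<circ> \<sigma> \<circ> inv \<sigma>))"
    by (simp add: inner_vec_def m(1) mor_act_coord[OF k m(2)] comp_def inv)
  also have "\<dots> = (\<Sum>p\<in>UNIV. (if \<forall>s. p s \<in> block k (f s) then t $ p else 0) \<bullet> t' $ (p \<circ> inv \<sigma>))"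
    by (rule sum.reindex_bij_betw[OF bij_comp_right[OF m(2)],
          of "\<lambda>p. (if \<forall>s. p s \<in> block k (f s) then t $ p else 0) \<bullet> t' $ (p \<circ> inv \<sigma>)"])
  also have "\<dots> = t \<bullet> mor_act k (mor_inv m) t'"
    by (auto simp: inner_vec_def m(1) mor_act_coord[OF k inv(1)] all intro!: sum.cong)
  finally show ?thesis .
qed

text \<open>The hypotheses of \<open>bicommutant\<close> hold: products come from
  \<open>A_module\<close>, adjoints from inverses in the groupoid, and the unit is the sum of all
  identity morphisms.\<close>

lemma centralizer_centralizer_A_image:
  fixes k :: "'l::{finite,linorder} \<Rightarrow> nat"
  assumes k: "(\<Sum>i\<in>UNIV. k i) = CARD('n::{finite,linorder})"
  shows "centralizer (centralizer (A_image k)) = (A_image k :: (('d::finite, 'n) tensor \<Rightarrow> _) set)"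
proof (rule bicommutant)
  let ?A = "A_image k :: (('d::finite, 'n) tensor \<Rightarrow> _) set"
  show "?A \<subseteq> endos"
    unfolding A_image_def by (auto intro!: lin_ext_endos mor_act_endos[OF k] simp: Mor_def)
  show "(\<lambda>t. U t + V t) \<in> ?A" if UV: "U \<in> ?A" "V \<in> ?A" for U V
  proof -
    obtain a b where "U = (\<lambda>t. \<Sum>m\<in>Mor. a m *s mor_act k m t)" "V = (\<lambda>t. \<Sum>m\<in>Mor. b m *s mor_act k m t)"
      using UV unfolding A_image_eq by blast
    then have "(\<lambda>t. U t + V t) = (\<lambda>t. \<Sum>m\<in>Mor. (a m + b m) *s mor_act k m t)"
      by (simp add: sum.distrib vec.scale_left_distrib)
    then show ?thesis unfolding A_image_eq by (auto intro!: exI[of _ "\<lambda>m. a m + b m"])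
  qed
  show "(\<lambda>t. c *s U t) \<in> ?A" if U: "U \<in> ?A" for c U
  proof -
    obtain a where "U = (\<lambda>t. \<Sum>m\<in>Mor. a m *s mor_act k m t)"
      using U unfolding A_image_eq by blast
    then have "(\<lambda>t. c *s U t) = (\<lambda>t. \<Sum>m\<in>Mor. (c * a m) *s mor_act k m t)"
      by (simp add: vec.scale_sum_right)
    then show ?thesis unfolding A_image_eq by (auto intro!: exI[of _ "\<lambda>m. c * a m"])
  qed
  show "U \<circ> V \<in> ?A" if UV: "U \<in> ?A" "V \<in> ?A" for U V
  proof -
    obtain a b where ab: "a \<in> free_space (Mor :: ('d, 'l) mor set)" "U = lin_ext (mor_act k) a"
      "b \<in> free_space (Mor :: ('d, 'l) mor set)" "V = lin_ext (mor_act k) b"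
      using UV unfolding A_image_def by blast
    have comp: "z \<in> Mor" if "mor_comp x y = Some z" "x \<in> Mor" "y \<in> Mor" for x y z :: "('d, 'l) mor"
      using that by (cases x; cases y) (auto simp: Mor_def bij_comp split: if_splits)
    have "conv mor_comp a b \<in> free_space Mor"
      unfolding free_space_def
    proof (clarsimp)
      fix f \<sigma> g assume "conv mor_comp a b (f, \<sigma>, g) \<noteq> 0"
      then obtain x y where "a x \<noteq> 0" "b y \<noteq> 0" "mor_comp x y = Some (f, \<sigma>, g)"
        unfolding conv_def by (auto elim!: sum.not_neutral_contains_not_neutral)
      moreover from this have "x \<in> Mor" "y \<in> Mor" using ab by (auto simp: free_space_def)
      ultimately show "(f, \<sigma>, g) \<in> Mor" using comp by blast
    qed
    then show ?thesis
      unfolding ab(2,4) A_module[OF k ab(1,3), symmetric] A_image_def by blast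
  qed
  show "id \<in> ?A"
  proof -
    have "id = (\<lambda>t :: ('d, 'n) tensor. \<Sum>f\<in>UNIV. 1 *s mor_act k (f, id, f) t)"
    proof (rule ext, unfold vec_eq_iff, rule allI)
      fix t :: "('d, 'n) tensor" and p :: "'d \<Rightarrow> 'n"
      \<comment> \<open>The coloring \<open>f0\<close> of \<open>p\<close> is the only object whose
        identity morphism keeps the coordinate \<open>p\<close>.\<close>
      define f0 where "f0 s = (THE i. p s \<in> block k i)" for s
      have "p s \<in> block k (f0 s)" for s
        unfolding f0_def using theI'[OF ex1_block[OF k, of "p s"]] .
      then have "(\<forall>s. p s \<in> block k (f s)) \<longleftrightarrow> f = f0" for f
        using ex1_block[OF k] by (metis ext)
      then show "id t $ p = (\<Sum>f\<in>UNIV. 1 *s mor_act k (f, id, f) t) $ p"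
        by (simp add: mor_act_coord[OF k])
    qed
    also have "\<dots> \<in> ?A"
      unfolding A_image_def by (rule lin_ext_combination)
        (simp_all add: Mor_def bij_id[unfolded id_def] id_def comp_def)
    finally show ?thesis .
  qed
  show "\<exists>V\<in>?A. \<forall>h h'. U h \<bullet> h' = h \<bullet> V h'" if U: "U \<in> ?A" for U
  proof -
    obtain a where a: "U = (\<lambda>t. \<Sum>m\<in>Mor. a m *s mor_act k m t)"
      using U unfolding A_image_eq by blast
    show ?thesis
    proof (rule bexI)
      show "(\<lambda>t. \<Sum>m\<in>Mor. cnj (a m) *s mor_act k (mor_inv m) t) \<in> ?A"
        unfolding A_image_def by (rule lin_ext_combination) (auto intro: mor_inv_Mor)
      show "\<forall>h h'. U h \<bullet> h' = h \<bullet> (\<Sum>m\<in>Mor. cnj (a m) *s mor_act k (mor_inv m) h')"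
      proof (intro allI)
        fix h h' :: "('d, 'n) tensor"
        have "(a m *s mor_act k m h) \<bullet> h' = h \<bullet> (cnj (a m) *s mor_act k (mor_inv m) h')"
          if "m \<in> Mor" for m
        proof -
          have "(a m *s mor_act k m h) \<bullet> h' = mor_act k m h \<bullet> (cnj (a m) *s h')"
            by (rule inner_cscale_left)
          also have "\<dots> = h \<bullet> mor_act k (mor_inv m) (cnj (a m) *s h')"
            by (rule inner_mor_act[OF k that])
          also have "mor_act k (mor_inv m) (cnj (a m) *s h') = cnj (a m) *s mor_act k (mor_inv m) h'"
          proof (rule endosD)
            show "(mor_act k (mor_inv m) :: ('d, 'n) tensor \<Rightarrow> _) \<in> endos"
              using mor_inv_Mor[OF that] by (auto simp: Mor_def intro: mor_act_endos[OF k])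
          qed
          finally show ?thesis .
        qed
        then show "U h \<bullet> h' = h \<bullet> (\<Sum>m\<in>Mor. cnj (a m) *s mor_act k (mor_inv m) h')"
          by (simp add: a inner_sum_left inner_sum_right)
      qed
    qed
  qed
qed

section \<open>Operators commuting with \<open>A\<close> come from the group algebra\<close>

lemma centralizer_A_image_subset:
  fixes k :: "'l::{finite,linorder} \<Rightarrow> nat"
  assumes k: "(\<Sum>i\<in>UNIV. k i) = CARD('n::{finite,linorder})"
  shows "centralizer (A_image k) \<subseteq> (GL_image k :: (('d::finite, 'n) tensor \<Rightarrow> ('d, 'n) tensor) set)"
proof
  fix T :: "('d, 'n) tensor \<Rightarrow> ('d, 'n) tensor"
  assume T: "T \<in> centralizer (A_image k)"
  then have Te: "T \<in> endos" by (simp add: centralizer_def)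
  \<comment> \<open>Here \<open>c\<close> colors the basis indices by their blocks, so
    \<open>c \<circ> p\<close> is the object whose summand contains \<open>axis p 1\<close>.\<close>
  define c where "c j = (THE i. j \<in> block k i)" for j :: 'n
  have c: "j \<in> block k i \<longleftrightarrow> c j = i" for j i
    unfolding c_def using theI'[OF ex1_block[OF k, of j]] ex1_block[OF k, of j] by blast
  define M where "M p q = T (axis q 1) $ p" for p q :: "'d \<Rightarrow> 'n"
  have M_shift: "M p q = (if c \<circ> p = c \<circ> q then M (p \<circ> \<sigma>) (q \<circ> \<sigma>) else 0)" if \<sigma>: "bij \<sigma>" for p q \<sigma>
  proof -
    \<comment> \<open>This morphism sends \<open>axis (q \<circ> \<sigma>) 1\<close> to
      \<open>axis q 1\<close>, so commuting with it compares the entries of \<open>T\<close> at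
      \<open>(p, q)\<close> and at \<open>(p \<circ> \<sigma>, q \<circ> \<sigma>)\<close>.\<close>
    let ?m = "(c \<circ> q \<circ> \<sigma>, \<sigma>, c \<circ> q)"
    have "?m \<in> Mor" using \<sigma> by (simp add: Mor_def)
    then have comm: "T (mor_act k ?m t) = mor_act k ?m (T t)" for t
      using T mor_act_in_A_image[of ?m k] by (auto simp: centralizer_def fun_eq_iff)
    have coord: "mor_act k ?m t $ p = (if c \<circ> p = c \<circ> q then t $ (p \<circ> \<sigma>) else 0)"
      for t :: "('d, 'n) tensor" and p
    proof -
      have "(\<forall>s. p (\<sigma> s) \<in> block k ((c \<circ> q \<circ> \<sigma>) s)) \<longleftrightarrow> (c \<circ> p) \<circ> \<sigma> = (c \<circ> q) \<circ> \<sigma>"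
        by (auto simp: c fun_eq_iff)
      also have "\<dots> \<longleftrightarrow> c \<circ> p = c \<circ> q"
        using bij_is_surj[OF \<sigma>] by (auto simp: fun_eq_iff) (metis surj_def)
      finally show ?thesis by (simp add: mor_act_coord[OF k \<sigma>])
    qed
    have "mor_act k ?m (axis (q \<circ> \<sigma>) 1) = (axis q 1 :: ('d, 'n) tensor)"
    proof -
      have "p \<circ> \<sigma> = q \<circ> \<sigma> \<longleftrightarrow> p = q" for p
        using bij_is_inj[OF bij_comp_right[OF \<sigma>]] by (auto simp: inj_def)
      then show ?thesis by (auto simp: vec_eq_iff coord axis_def)
    qed
    then have "M p q = mor_act k ?m (T (axis (q \<circ> \<sigma>) 1)) $ p"
      using comm[of "axis (q \<circ> \<sigma>) 1"] by (simp add: M_def)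
    then show ?thesis by (simp add: coord M_def)
  qed
  \<comment> \<open>For the identity permutation the morphism is the projection onto the summand of
    \<open>c \<circ> q\<close>.\<close>
  have M_zero: "M p q = 0" if "c \<circ> p \<noteq> c \<circ> q" for p q
    using M_shift[OF bij_id, of p q] that by metis
  have M_inv: "M (p \<circ> \<sigma>) (q \<circ> \<sigma>) = M p q" if \<sigma>: "bij \<sigma>" for p q \<sigma>
  proof (cases "c \<circ> p = c \<circ> q")
    case False
    then have "c \<circ> (p \<circ> \<sigma>) \<noteq> c \<circ> (q \<circ> \<sigma>)"
      using bij_is_surj[OF \<sigma>] by (auto simp: fun_eq_iff) (metis surj_def)
    then show ?thesis using False M_zero by metis
  qed (use M_shift[OF \<sigma>, of p q] in simp)

  \<comment> \<open>The matrix \<open>e p q S\<close> is the sum of the matrix units at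
    \<open>(p s, q s)\<close> for \<open>s \<in> S\<close>, so its absolute row sums are at most
    \<open>CARD('d)\<close>. One more makes the dominance in \<open>y\<close> strict.\<close>
  define r where "r = real (CARD('d) + 1)"
  define e where "e p q S = (\<chi> a b. \<Sum>s\<in>S. if p s = a \<and> q s = b then 1 else (0 :: complex))"
    for p q :: "'d \<Rightarrow> 'n" and S
  define y where "y p q S = (\<chi> a b. (if a = b then of_real r else 0) + e p q S $ a $ b)"
    for p q :: "'d \<Rightarrow> 'n" and S
  have y_GL: "y p q S \<in> GL k" if pq: "c \<circ> p = c \<circ> q" for p q S
  proof -
    have "(\<Sum>b\<in>UNIV. norm (e p q S $ a $ b)) < r" for a
    proof -
      have "(\<Sum>b\<in>UNIV. norm (e p q S $ a $ b)) \<le>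
          (\<Sum>b\<in>UNIV. \<Sum>s\<in>S. if p s = a \<and> q s = b then 1 else 0)"
        unfolding e_def by (auto intro!: sum_mono sum_norm_le)
      also have "\<dots> = (\<Sum>s\<in>S. \<Sum>b\<in>UNIV. if p s = a \<and> q s = b then 1 else 0)"
        by (rule sum.swap)
      also have "\<dots> \<le> (\<Sum>s\<in>S. 1)"
      proof (rule sum_mono)
        fix s show "(\<Sum>b\<in>UNIV. if p s = a \<and> q s = b then 1 else 0) \<le> (1 :: real)"
          by (cases "p s = a") simp_all
      qed
      also have "\<dots> \<le> real CARD('d)" by (simp add: card_mono)
      finally show ?thesis by (simp add: r_def)
    qed
    then have "invertible (y p q S)"
      unfolding y_def by (rule invertible_if_row_dominant)
    moreover have "c a = c b" if nz: "y p q S $ a $ b \<noteq> 0" for a b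
    proof (rule ccontr)
      assume "c a \<noteq> c b"
      then have "\<not> (p s = a \<and> q s = b)" for s using pq by (auto simp: fun_eq_iff)
      then have "e p q S $ a $ b = 0" unfolding e_def by (auto intro!: sum.neutral)
      moreover have "a \<noteq> b" using \<open>c a \<noteq> c b\<close> by auto
      ultimately show False using nz by (simp add: y_def)
    qed
    ultimately show ?thesis by (auto simp: GL_def c)
  qed

  let ?B = "{\<sigma> :: 'd \<Rightarrow> 'd. bij \<sigma>}"
  have B: "of_nat (card ?B) \<noteq> (0 :: complex)"
    using bij_id by (auto simp: card_eq_0_iff)
  let ?I = "{(p, q). c \<circ> p = c \<circ> q} \<times> (UNIV :: 'd set set)"
  \<comment> \<open>The sign is that of \<open>polarization\<close>. The polarized sum runs over all
    bijections, each of which will contribute \<open>M p q\<close>, hence the division by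
    \<open>card ?B\<close>.\<close>
  define \<gamma> where "\<gamma> p q S = M p q * (- 1) ^ card (- S) / of_nat (card ?B)"
    for p q :: "'d \<Rightarrow> 'n" and S :: "'d set"
  define U :: "('d, 'n) tensor \<Rightarrow> ('d, 'n) tensor" where
    "U t = (\<Sum>i\<in>?I. \<gamma> (fst (fst i)) (snd (fst i)) (snd i) *s
      gl_act (y (fst (fst i)) (snd (fst i)) (snd i)) t)" for t
  have U: "U \<in> GL_image k"
    unfolding U_def GL_image_def by (rule lin_ext_combination[OF finite])
      (clarify, simp only: fst_conv snd_conv y_GL)
  have "T = U"
  proof (rule endos_eqI[OF Te])
    show "U \<in> endos"
      using U unfolding GL_image_def by (auto intro: lin_ext_endos gl_act_endos)
    fix q :: "'d \<Rightarrow> 'n"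
    have "U (axis q 1) $ p = M p q" for p
    proof -
      have pol: "(\<Sum>S\<in>UNIV. (- 1) ^ card (- S) * (\<Prod>j\<in>UNIV. y p' q' S $ p j $ q j)) =
          (\<Sum>\<sigma>\<in>?B. if p' \<circ> \<sigma> = p \<and> q' \<circ> \<sigma> = q then 1 else 0)" for p' q'
      proof -
        \<comment> \<open>In \<open>polarization\<close> the part \<open>b\<close> is the entry of
          the scalar matrix with diagonal \<open>r\<close>, which drops out, and \<open>u s\<close>
          is the entry of the matrix unit at \<open>(p' s, q' s)\<close>.\<close>
        have "(\<Sum>S\<in>UNIV. (- 1) ^ card (- S) * (\<Prod>j\<in>UNIV. y p' q' S $ p j $ q j)) =
          (\<Sum>\<sigma>\<in>?B. \<Prod>j\<in>UNIV. if p' (\<sigma> j) = p j \<and> q' (\<sigma> j) = q j then 1 else 0)"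
          unfolding y_def e_def vec_lambda_beta by (rule polarization)
        also have "\<dots> = (\<Sum>\<sigma>\<in>?B. if p' \<circ> \<sigma> = p \<and> q' \<circ> \<sigma> = q then 1 else 0)"
        proof (rule sum.cong[OF refl])
          fix \<sigma> :: "'d \<Rightarrow> 'd"
          show "(\<Prod>j\<in>UNIV. if p' (\<sigma> j) = p j \<and> q' (\<sigma> j) = q j then 1 else 0) =
            (if p' \<circ> \<sigma> = p \<and> q' \<circ> \<sigma> = q then 1 else 0 :: complex)"
            by (auto simp: fun_eq_iff intro!: prod_zero)
        qed
        finally show ?thesis .
      qed
      have "U (axis q 1) $ p = (\<Sum>((p', q'), S)\<in>?I. \<gamma> p' q' S * (\<Prod>j\<in>UNIV. y p' q' S $ p j $ q j))"
        by (simp add: U_def gl_act_axis case_prod_beta)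
      also have "\<dots> = (\<Sum>(p', q') | c \<circ> p' = c \<circ> q'.
          \<Sum>S\<in>UNIV. \<gamma> p' q' S * (\<Prod>j\<in>UNIV. y p' q' S $ p j $ q j))"
        by (subst sum.cartesian_product[symmetric]) (simp add: case_prod_beta)
      \<comment> \<open>Pairs with different colorings may be added, even if their \<open>y\<close>
        lies outside \<open>GL k\<close>, because \<open>M\<close> gives them coefficient 0.\<close>
      also have "\<dots> = (\<Sum>(p', q')\<in>UNIV. \<Sum>S\<in>UNIV. \<gamma> p' q' S * (\<Prod>j\<in>UNIV. y p' q' S $ p j $ q j))"
        proof (rule sum.mono_neutral_left)
        have "\<gamma> p' q' S = 0" if "c \<circ> p' \<noteq> c \<circ> q'" for p' q' S
          using M_zero[OF that] by (simp add: \<gamma>_def)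
        then show "\<forall>i\<in>UNIV - {(p', q'). c \<circ> p' = c \<circ> q'}.
            (case i of (p', q') \<Rightarrow> \<Sum>S\<in>UNIV. \<gamma> p' q' S * (\<Prod>j\<in>UNIV. y p' q' S $ p j $ q j)) = 0"
          by (auto intro!: sum.neutral) blast
      qed simp_all
      also have "\<dots> = (\<Sum>(p', q')\<in>UNIV. \<Sum>\<sigma>\<in>?B.
          if p' \<circ> \<sigma> = p \<and> q' \<circ> \<sigma> = q then M p' q' / of_nat (card ?B) else 0)"
      proof (intro sum.cong refl, clarify)
        fix p' q' :: "'d \<Rightarrow> 'n"
        have "(\<Sum>S\<in>UNIV. \<gamma> p' q' S * (\<Prod>j\<in>UNIV. y p' q' S $ p j $ q j)) =
            M p' q' / of_nat (card ?B) *
            (\<Sum>S\<in>UNIV. (- 1) ^ card (- S) * (\<Prod>j\<in>UNIV. y p' q' S $ p j $ q j))"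
          by (simp add: \<gamma>_def sum_distrib_left mult.assoc)
        then show "(\<Sum>S\<in>UNIV. \<gamma> p' q' S * (\<Prod>j\<in>UNIV. y p' q' S $ p j $ q j)) =
            (\<Sum>\<sigma>\<in>?B. if p' \<circ> \<sigma> = p \<and> q' \<circ> \<sigma> = q then M p' q' / of_nat (card ?B) else 0)"
          unfolding pol by (simp add: sum_distrib_left if_distrib cong: if_cong)
      qed
      also have "\<dots> = (\<Sum>\<sigma>\<in>?B. \<Sum>(p', q')\<in>UNIV.
          if p' \<circ> \<sigma> = p \<and> q' \<circ> \<sigma> = q then M p' q' / of_nat (card ?B) else 0)"
        unfolding case_prod_beta by (rule sum.swap)
      also have "\<dots> = (\<Sum>\<sigma>\<in>?B. M p q / of_nat (card ?B))"
      \<comment> \<open>For fixed \<open>\<sigma>\<close> only the pair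
        \<open>(p \<circ> inv \<sigma>, q \<circ> inv \<sigma>)\<close> survives, and there
        \<open>M\<close> has its value at \<open>(p, q)\<close>.\<close>
      proof (rule sum.cong[OF refl])
        fix \<sigma> assume "\<sigma> \<in> ?B"
        then have \<sigma>: "bij \<sigma>" "bij (inv \<sigma>)" by (auto simp: bij_imp_bij_inv)
        then have eq: "p' \<circ> \<sigma> = p \<longleftrightarrow> p' = p \<circ> inv \<sigma>" for p' p :: "'d \<Rightarrow> 'n"
          using surj_iff[THEN iffD1, OF bij_is_surj[OF \<sigma>(1)]] inv_o_cancel[OF bij_is_inj[OF \<sigma>(1)]]
          by (auto simp: comp_assoc)
        have "(\<Sum>(p', q')\<in>UNIV. if p' \<circ> \<sigma> = p \<and> q' \<circ> \<sigma> = q then M p' q' / of_nat (card ?B) else 0) =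
            (\<Sum>z\<in>UNIV. if z = (p \<circ> inv \<sigma>, q \<circ> inv \<sigma>)
              then M (p \<circ> inv \<sigma>) (q \<circ> inv \<sigma>) / of_nat (card ?B) else 0)"
          by (rule sum.cong[OF refl]) (auto simp: eq split: if_splits)
        then show "(\<Sum>(p', q')\<in>UNIV. if p' \<circ> \<sigma> = p \<and> q' \<circ> \<sigma> = q then M p' q' / of_nat (card ?B) else 0) =
            M p q / of_nat (card ?B)"
          by (simp add: M_inv[OF \<sigma>(2)])
      qed
      also have "\<dots> = M p q" using B by simp
      finally show ?thesis .
    qed
    then show "T (axis q 1) = U (axis q 1)" by (simp add: vec_eq_iff M_def)
  qed
  then show "T \<in> GL_image k" using U by simp
qed

theorem theorem9:
  fixes k :: "'l::{finite,linorder} \<Rightarrow> nat"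
  assumes "CARD('l) \<le> CARD('n::{finite,linorder})"
    and "\<And>i. k i > 0"
    and "(\<Sum>i\<in>UNIV. k i) = CARD('n)"
  shows "(A_image k :: (('d::finite, 'n) tensor \<Rightarrow> ('d, 'n) tensor) set)
           = centralizer (GL_image k) \<and>
         (GL_image k :: (('d, 'n) tensor \<Rightarrow> ('d, 'n) tensor) set)
           = centralizer (A_image k)"
proof -
  note k = assms(3)
  have "GL_image k \<subseteq> centralizer (A_image k :: (('d, 'n) tensor \<Rightarrow> _) set)"
  proof
    fix U :: "('d, 'n) tensor \<Rightarrow> ('d, 'n) tensor" assume "U \<in> GL_image k"
    then obtain a where a: "a \<in> free_space (GL k)" "U = lin_ext gl_act a"
      by (auto simp: GL_image_def)
    then have U: "U \<in> endos" by (auto intro: lin_ext_endos gl_act_endos)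
    have "U \<circ> mor_act k m = mor_act k m \<circ> U" if m: "m \<in> Mor" for m
    proof -
      have "(mor_act k m :: ('d, 'n) tensor \<Rightarrow> _) \<in> endos"
        using m by (auto simp: Mor_def intro: mor_act_endos[OF k])
      then show ?thesis
        \<comment> \<open>Commutation extends linearly first from group elements to
          \<open>U\<close>, and afterwards from morphisms to all of
          \<open>A_image k\<close>.\<close>
        unfolding a(2) by (intro lin_ext_commute[OF _ a(1), symmetric] mor_act_gl_act_commute[OF k m])
    qed
    then show "U \<in> centralizer (A_image k)"
      using U by (auto simp: centralizer_def A_image_def intro!: lin_ext_commute)
  qed
  then have "GL_image k = centralizer (A_image k :: (('d, 'n) tensor \<Rightarrow> _) set)"
    using centralizer_A_image_subset[OF k] by blast
  \<comment> \<open>Substituting this equality into the bicommutant identity for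
    \<open>A_image k\<close> gives the other half.\<close>
  then show ?thesis using centralizer_centralizer_A_image[OF k] by auto
qed

end
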